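(* Let $\mu$ be a probability measure on $[0,1]$, absolutely continuous with continuous density $f_\mu$ that is single-dipped, and let $q\in(0,1)$. If $\mu$ is symmetric ($f_\mu(x)=f_\mu(1-x)$ for all $x$), then the percentile mechanism $\mathcal{PM}_p$ with $p=\frac q2$ is optimal; in general, at least one of the percentile mechanisms $\mathcal{PM}_{q/2}$ and $\mathcal{PM}_{1-q/2}$ is optimal.
   Context: Single-dipped: there is $m\in[0,1]$ such that $f_\mu$ is non-increasing on $[0,m]$, non-decreasing on $[m,1]$, and $m$ is the unique minimizer of $f_\mu$. Single-facility setting: $n$ agents at $\vec x\in[0,1]^n$; a facility at $y$ with capacity $q$ accommodates the $\lfloor qn\rfloor$ agents closest to $y$ (ties arbitrary); an accommodated agent $i$ gets utility $1-|x_i-y|$, others $0$; normalized social welfare $SW(\vec x,y)=\frac1n\sum_i u_i$. $\mathcal{PM}_p$ places the facility at the $(\lfloor p(n-1)\rfloor+1)$-th smallest reported position. $R_{\mu,q}(y)$ is the smallest $r\ge0$ with $\mu([y-r,y+r])=q$, and $\mathcal{W}(y)=\int_{[y-R_{\mu,q}(y),y+R_{\mu,q}(y)]}|x-y|\,d\mu(x)$. With $X_1,\dots,X_n$ i.i.d. of law $\mu$, $\mathcal{PM}_p$ is optimal if $\lim_{n\to\infty}\mathbb{E}[SW(\vec X,\mathcal{PM}_p(\vec X))]$ exists and equals $\max_{y\in[0,1]}(q-\mathcal{W}(y))$. *)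

theory Defs
  imports "HOL-Probability.Probability"
begin

definition dens_measure :: "(real \<Rightarrow> real) \<Rightarrow> real measure" where
  "dens_measure f = density lborel (\<lambda>x. ennreal (indicator {0..1} x * f x))"

definition prob_density :: "(real \<Rightarrow> real) \<Rightarrow> bool" where
  "prob_density f \<longleftrightarrow> (\<forall>x\<in>{0..1}. 0 \<le> f x) \<and> f integrable_on {0..1}
      \<and> integral {0..1} f = 1"

definition single_dipped :: "(real \<Rightarrow> real) \<Rightarrow> bool" where
  "single_dipped f \<longleftrightarrow> (\<exists>m\<in>{0..1}.
      (\<forall>x\<in>{0..m}. \<forall>y\<in>{0..m}. x \<le> y \<longrightarrow> f y \<le> f x) \<and>
      (\<forall>x\<in>{m..1}. \<forall>y\<in>{m..1}. x \<le> y \<longrightarrow> f x \<le> f y) \<and>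
      (\<forall>x\<in>{0..1}. x \<noteq> m \<longrightarrow> f m < f x))"

text \<open>Sets of agents (indices below n) that may be accommodated by a facility at y with
  capacity q: floor(q n) agents closest to y, ties broken arbitrarily.\<close>
definition accommodated :: "nat \<Rightarrow> real \<Rightarrow> (nat \<Rightarrow> real) \<Rightarrow> real \<Rightarrow> nat set set" where
  "accommodated n q x y = {S. S \<subseteq> {..<n} \<and> card S = nat \<lfloor>q * real n\<rfloor> \<and>
      (\<forall>i\<in>S. \<forall>j\<in>{..<n} - S. \<bar>x i - y\<bar> \<le> \<bar>x j - y\<bar>)}"

definition SW :: "nat \<Rightarrow> real \<Rightarrow> (nat \<Rightarrow> real) \<Rightarrow> real \<Rightarrow> real" where
  "SW n q x y = (1 / real n) *
      (\<Sum>i\<in>(SOME S. S \<in> accommodated n q x y). 1 - \<bar>x i - y\<bar>)"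

definition PM :: "real \<Rightarrow> nat \<Rightarrow> (nat \<Rightarrow> real) \<Rightarrow> real" where
  "PM p n x = sort (map x [0..<n]) ! nat \<lfloor>p * (real n - 1)\<rfloor>"

definition Rad :: "real measure \<Rightarrow> real \<Rightarrow> real \<Rightarrow> real" where
  "Rad \<mu> q y = Inf {r. 0 \<le> r \<and> measure \<mu> {y - r..y + r} = q}"

definition Wc :: "real measure \<Rightarrow> real \<Rightarrow> real \<Rightarrow> real" where
  "Wc \<mu> q y = set_lebesgue_integral \<mu> {y - Rad \<mu> q y..y + Rad \<mu> q y} (\<lambda>x. \<bar>x - y\<bar>)"

definition optimal_PM :: "real measure \<Rightarrow> real \<Rightarrow> real \<Rightarrow> bool" where
  "optimal_PM \<mu> q p \<longleftrightarrow> (\<exists>y0\<in>{0..1}. (\<forall>y\<in>{0..1}. q - Wc \<mu> q y \<le> q - Wc \<mu> q y0) \<and>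
      (\<lambda>n. integral\<^sup>L (PiM {..<n} (\<lambda>_. \<mu>)) (\<lambda>x. SW n q x (PM p n x)))
        \<longlonglongrightarrow> q - Wc \<mu> q y0)"

end

theory Submission
  imports Defs
begin

text \<open>Let \<open>Q\<close> be the quantile function of \<open>\<mu>\<close> and \<open>h = q / 2\<close>. Whatever the position \<open>y\<close>, the accommodated
  agents fill a quantile interval \<open>[a, a + q]\<close>, so \<open>\<W>(y) \<ge> V(a)\<close>, the cost of serving this interval
  from its median \<open>Q(a + h)\<close>; conversely \<open>\<W>(Q(a + h)) \<le> V(a)\<close>, since serving the closest agents is
  cheapest. Now \<open>V'(a) = Q(a + q) - 2 Q(a + h) + Q(a)\<close>, and \<open>Q\<close> is convex up to the dip and concave after
  it, so \<open>V'\<close> changes sign at most once, from plus to minus. Hence \<open>V\<close> is smallest at \<open>a = 0\<close> or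
  \<open>a = 1 - q\<close>, that is, \<open>\<W>\<close> is smallest at \<open>Q(h)\<close> or \<open>Q(1 - h)\<close>; under symmetry both values agree.

  The welfare is 1-Lipschitz in the facility position, and at a fixed position it differs from the
  empirical average of \<open>1 - \<bar>x - y\<bar>\<close> over the ball of measure \<open>q\<close> by at most the deviation of the
  empirical measure of this ball from \<open>q\<close>. So the limit reduces to the fact that the empirical measure
  of an interval converges in \<open>L\<^sup>1\<close>, which also moves the sample percentile to \<open>Q(p)\<close>.\<close>

section \<open>Second differences of convex-concave functions\<close>

text \<open>The triples \<open>x, y, y + h\<close> and \<open>x, x + h, y + h\<close> share the long
  chord from \<open>x\<close> to \<open>y + h\<close>. It is at least as steep as the chord over
  \<open>[x, x + h]\<close> and at most as steep as the one over \<open>[y, y + h]\<close>. Slopes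
  are compared in cross-multiplied form.\<close>

lemma increment_mono_of_slope_mono:
  fixes Q :: "real \<Rightarrow> real"
  assumes slope: "\<And>x y z. A \<le> x \<Longrightarrow> x < y \<Longrightarrow> y < z \<Longrightarrow> z \<le> B
      \<Longrightarrow> (Q y - Q x) * (z - y) \<le> (Q z - Q y) * (y - x)"
    and "A \<le> x" "x \<le> y" "0 < h" "y + h \<le> B"
  shows "Q (x + h) - Q x \<le> Q (y + h) - Q y"
proof (cases "x = y")
  case False
  then have "x < y" using assms by simp
  have "(Q y - Q x) * h \<le> (Q (y + h) - Q y) * (y - x)"
    using slope[of x y "y + h"] assms \<open>x < y\<close> by simp
  moreover have "(Q (x + h) - Q x) * (y - x) \<le> (Q (y + h) - Q (x + h)) * h"
    using slope[of x "x + h" "y + h"] assms \<open>x < y\<close> by simp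
  ultimately have "(Q (x + h) - Q x) * (h + (y - x)) \<le> (Q (y + h) - Q y) * (h + (y - x))"
    by (simp add: algebra_simps)
  then show ?thesis using assms \<open>x < y\<close> by (simp add: mult_le_cancel_right)
qed simp

text \<open>Outside of \<open>[M - h, M]\<close> the increment is monotone, and inside it is concave.\<close>
lemma increment_quasiconcave:
  fixes Q :: "real \<Rightarrow> real"
  assumes convex: "\<And>x y z. 0 \<le> x \<Longrightarrow> x < y \<Longrightarrow> y < z \<Longrightarrow> z \<le> M
      \<Longrightarrow> (Q y - Q x) * (z - y) \<le> (Q z - Q y) * (y - x)"
    and concave: "\<And>x y z. M \<le> x \<Longrightarrow> x < y \<Longrightarrow> y < z \<Longrightarrow> z \<le> 1
      \<Longrightarrow> (Q z - Q y) * (y - x) \<le> (Q y - Q x) * (z - y)"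
    and h: "0 < h" "0 \<le> x" "x \<le> y" "y \<le> z" "z + h \<le> 1"
  shows "min (Q (x + h) - Q x) (Q (z + h) - Q z) \<le> Q (y + h) - Q y"
proof (rule ccontr)
  define G where "G u = Q (u + h) - Q u" for u
  assume "\<not> ?thesis"
  then have Gx: "G y < G x" and Gz: "G y < G z" by (auto simp: G_def)
  have up: "G u \<le> G v" if "0 \<le> u" "u \<le> v" "v + h \<le> M" for u v
    unfolding G_def by (rule increment_mono_of_slope_mono[of 0 M Q])
      (use convex that \<open>0 < h\<close> in auto)
  have down: "G v \<le> G u" if "M \<le> u" "u \<le> v" "v + h \<le> 1" for u v
    using increment_mono_of_slope_mono[of M 1 "\<lambda>u. - Q u" u v h] concave that \<open>0 < h\<close>
    by (fastforce simp: G_def algebra_simps)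
  have y: "M - h < y" "y < M"
    using up[of x y] down[of y z] Gx Gz h by linarith+
  \<comment> \<open>Clipping to \<open>[M - h, M]\<close> does not lower \<open>G\<close> at the
    outer points. It puts \<open>x'\<close>, \<open>y\<close>, \<open>z'\<close> into the convex
    range of \<open>Q\<close> and their shifts by \<open>h\<close> into the concave range.\<close>
  define x' where "x' = max x (M - h)"
  define z' where "z' = min z M"
  have x': "0 \<le> x'" "x' \<le> y" "M \<le> x' + h" "G y < G x'"
    using up[of x x'] y Gx h by (auto simp: x'_def max_def split: if_splits)
  have z': "y \<le> z'" "z' \<le> M" "z' + h \<le> 1" "G y < G z'"
    using down[of z' z] y Gz h by (auto simp: z'_def min_def split: if_splits)
  have lt: "x' < y" "y < z'" using x' z' by (auto simp: order.order_iff_strict)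
  \<comment> \<open>The next four inequalities close up to a cycle, and two of them are
    strict.\<close>
  have "(Q (y + h) - Q (x' + h)) * (z' - y) < (Q y - Q x') * (z' - y)"
    using x' lt by (simp add: G_def)
  moreover have "(Q (z' + h) - Q (y + h)) * (y - x') \<le> (Q (y + h) - Q (x' + h)) * (z' - y)"
    using concave[of "x' + h" "y + h" "z' + h"] x' z' lt by (simp add: algebra_simps)
  moreover have "(Q z' - Q y) * (y - x') < (Q (z' + h) - Q (y + h)) * (y - x')"
    using z' lt by (simp add: G_def)
  moreover have "(Q y - Q x') * (z' - y) \<le> (Q z' - Q y) * (y - x')"
    using convex[of x' y z'] x' z' lt by simp
  ultimately show False by linarith
qed

text \<open>Quasiconcavity rules out valleys: from \<open>b + h\<close> on, where \<open>G\<close>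
  has dropped below \<open>G b\<close>, it cannot rise again, and between \<open>b\<close> and
  \<open>b + h\<close> it is at least \<open>G (b + h)\<close>. The second fact serves when the two
  steps overlap.\<close>

lemma quasiconcave_step_nonincreasing:
  fixes G :: "real \<Rightarrow> real"
  assumes quasi: "\<And>x y z. A \<le> x \<Longrightarrow> x \<le> y \<Longrightarrow> y \<le> z \<Longrightarrow> z \<le> B \<Longrightarrow> min (G x) (G z) \<le> G y"
    and "A \<le> b" "b \<le> a" "0 \<le> h" "a + h \<le> B" "G (b + h) < G b"
  shows "G (a + h) \<le> G a"
proof (cases "a \<le> b + h")
  case True
  then show ?thesis
    using quasi[of b a "b + h"] quasi[of b "b + h" "a + h"] assms(2-)
    unfolding min_le_iff_disj by linarith
next
  case False
  then show ?thesis
    using quasi[of b "b + h" a] quasi[of b a "a + h"] assms(2-)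
    unfolding min_le_iff_disj by linarith
qed

text \<open>The derivative of the second difference of \<open>K\<close> is the second difference of
  \<open>Q\<close>, that is, a step of the quasiconcave increment of \<open>Q\<close>. Once
  negative, it stays nonpositive.\<close>

lemma second_difference_ge_min_endpoints:
  fixes Q K :: "real \<Rightarrow> real"
  assumes convex: "\<And>x y z. 0 \<le> x \<Longrightarrow> x < y \<Longrightarrow> y < z \<Longrightarrow> z \<le> M
      \<Longrightarrow> (Q y - Q x) * (z - y) \<le> (Q z - Q y) * (y - x)"
    and concave: "\<And>x y z. M \<le> x \<Longrightarrow> x < y \<Longrightarrow> y < z \<Longrightarrow> z \<le> 1
      \<Longrightarrow> (Q z - Q y) * (y - x) \<le> (Q y - Q x) * (z - y)"
    and deriv: "\<And>u. u \<in> {0..1} \<Longrightarrow> (K has_real_derivative Q u) (at u within {0..1})"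
    and h: "0 < h" "0 \<le> a" "a + 2 * h \<le> 1"
  shows "min (K (2 * h) - 2 * K h + K 0) (K 1 - 2 * K (1 - h) + K (1 - 2 * h))
    \<le> K (a + 2 * h) - 2 * K (a + h) + K a"
proof -
  define V where "V u = K (u + 2 * h) - 2 * K (u + h) + K u" for u
  define D where "D u = Q (u + 2 * h) - 2 * Q (u + h) + Q u" for u
  have cK: "continuous_on {0..1} K"
    by (rule DERIV_continuous_on[OF deriv])
  have cV: "continuous_on {0..1 - 2 * h} V"
    unfolding V_def
    by (intro continuous_intros continuous_on_compose2[OF cK]) (use \<open>0 < h\<close> in auto)
  have dK: "(K has_real_derivative Q u) (at u)" if "0 < u" "u < 1" for u
    using deriv[of u] at_within_Icc_at[of 0 u 1] that by simp
  have dV: "(V has_real_derivative D u) (at u)" if "0 < u" "u < 1 - 2 * h" for u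
  proof -
    have "((\<lambda>u. K (u + c)) has_real_derivative Q (u + c)) (at u)" if "0 \<le> c" "c \<le> 2 * h" for c
      using dK[of "u + c"] that \<open>0 < u\<close> \<open>u < 1 - 2 * h\<close> by (simp add: DERIV_shift)
    from this[of "2 * h"] this[of h] this[of 0] show ?thesis
      unfolding V_def D_def using \<open>0 < h\<close>
      by (auto intro!: derivative_eq_intros)
  qed
  have D: "D u = (Q (u + h + h) - Q (u + h)) - (Q (u + h) - Q u)" for u
    by (simp add: D_def algebra_simps)
  have "V 0 \<le> V a \<or> V (1 - 2 * h) \<le> V a"
  \<comment> \<open>Without a negative value of \<open>D\<close> up to \<open>a\<close>,
    \<open>V\<close> climbs from 0 to \<open>a\<close>; with one, \<open>V\<close> falls from
    \<open>a\<close> to the right end.\<close>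
  proof (cases "\<exists>b\<in>{0..a}. D b < 0")
    case False
    have "V 0 \<le> V a"
    proof (rule DERIV_nonneg_imp_increasing_open[where f = V])
      show "continuous_on {0..a} V"
        by (rule continuous_on_subset[OF cV]) (use h in auto)
      fix u assume "0 < u" "u < a"
      then show "\<exists>y. (V has_real_derivative y) (at u) \<and> 0 \<le> y"
        using dV[of u] False h by (intro exI[of _ "D u"]) (auto simp: not_less)
    qed (fact h)
    then show ?thesis ..
  next
    case True
    then obtain b where b: "0 \<le> b" "b \<le> a" "D b < 0" by auto
    have "V (1 - 2 * h) \<le> V a"
    proof (rule DERIV_nonpos_imp_decreasing_open[where f = V])
      show "continuous_on {a..1 - 2 * h} V"
        by (rule continuous_on_subset[OF cV]) (use h in auto)
      fix u assume u: "a < u" "u < 1 - 2 * h"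
      have "Q (u + h + h) - Q (u + h) \<le> Q (u + h) - Q u"
      proof (rule quasiconcave_step_nonincreasing[of 0 "1 - h" "\<lambda>u. Q (u + h) - Q u" b])
        show "min (Q (x + h) - Q x) (Q (z + h) - Q z) \<le> Q (y + h) - Q y"
          if "0 \<le> x" "x \<le> y" "y \<le> z" "z \<le> 1 - h" for x y z
          by (rule increment_quasiconcave[of M Q h x y z]) (use that convex concave h in auto)
      qed (use b u h D[of b] in auto)
      then show "\<exists>y. (V has_real_derivative y) (at u) \<and> y \<le> 0"
        using dV[of u] u h D[of u] by (intro exI[of _ "D u"]) auto
    qed (use h in auto)
    then show ?thesis ..
  qed
  then show ?thesis by (auto simp: V_def algebra_simps)
qed

section \<open>Welfare of a given sample\<close>

text \<open>This gives the choice in \<open>SW\<close> its meaning. A set of the right size with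
  least total distance works, since exchanging a member for a closer outsider would lower the
  total.\<close>

lemma accommodated_nonempty:
  assumes "0 \<le> q" "q \<le> 1"
  shows "accommodated n q x y \<noteq> {}"
proof -
  define k where "k = nat \<lfloor>q * real n\<rfloor>"
  define F where "F = {S. S \<subseteq> {..<n} \<and> card S = k}"
  define d where "d S = (\<Sum>i\<in>S. \<bar>x i - y\<bar>)" for S
  have "q * real n \<le> real n" using assms by (simp add: mult_left_le_one_le)
  then have "k \<le> n" unfolding k_def by linarith
  then have "{..<k} \<in> F" by (auto simp: F_def)
  moreover have "finite F" unfolding F_def by (rule finite_subset[of _ "Pow {..<n}"]) auto
  ultimately obtain S where S: "S \<in> F" and min: "\<And>T. T \<in> F \<Longrightarrow> d S \<le> d T"
    using arg_min_if_finite(1)[of F d] arg_min_least[of F _ d] by blast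
  have fin: "finite S" using S finite_subset by (auto simp: F_def)
  have "\<bar>x i - y\<bar> \<le> \<bar>x j - y\<bar>" if "i \<in> S" "j \<in> {..<n} - S" for i j
  proof -
    have "insert j (S - {i}) \<in> F"
      using S that card_Suc_Diff1[OF fin \<open>i \<in> S\<close>] fin by (auto simp: F_def)
    from min[OF this] show ?thesis
      using that fin by (simp add: d_def sum.remove[of S i])
  qed
  then have "S \<in> accommodated n q x y"
    using S by (auto simp: accommodated_def F_def k_def)
  then show ?thesis by auto
qed

lemma some_accommodated:
  assumes "0 \<le> q" "q \<le> 1"
  shows "(SOME S. S \<in> accommodated n q x y) \<in> accommodated n q x y"
  using accommodated_nonempty[OF assms] by (simp add: some_in_eq)

text \<open>\<open>S - T\<close> and \<open>T - S\<close> have equally many agents, and the best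
  utility \<open>c\<close> within \<open>T - S\<close> is a lower bound for every utility within
  \<open>S - T\<close>.\<close>

lemma accommodated_sum_maximal:
  assumes S: "S \<in> accommodated n q x y" and T: "T \<subseteq> {..<n}" "card T = nat \<lfloor>q * real n\<rfloor>"
  shows "(\<Sum>i\<in>T. 1 - \<bar>x i - y\<bar>) \<le> (\<Sum>i\<in>S. 1 - \<bar>x i - y\<bar>)"
proof -
  let ?u = "\<lambda>i. 1 - \<bar>x i - y\<bar>"
  have fin: "finite S" "finite T" and card: "card S = card T"
    using S T finite_subset by (auto simp: accommodated_def)
  have card': "card (T - S) = card (S - T)"
    using card fin by (simp add: card_Diff_subset_Int Int_commute)
  have u: "?u j \<le> ?u i" if "i \<in> S - T" "j \<in> T - S" for i j
    using S T that by (auto simp: accommodated_def)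
  have "sum ?u (T - S) \<le> sum ?u (S - T)"
  proof (cases "T - S = {}")
    case True
    moreover have "S - T = {}" using card' fin True by (metis card_0_eq card.empty finite_Diff)
    ultimately show ?thesis by (simp only: sum.empty order.refl)
  next
    case False
    define c where "c = Max (?u ` (T - S))"
    have "c \<in> ?u ` (T - S)" unfolding c_def using fin False by (intro Max_in) auto
    then have "c \<le> ?u i" if "i \<in> S - T" for i using u[OF that] by auto
    then have "real (card (S - T)) * c \<le> sum ?u (S - T)"
      by (intro sum_bounded_below)
    moreover have "?u j \<le> c" if "j \<in> T - S" for j
      unfolding c_def using fin that by (intro Max_ge) auto
    then have "sum ?u (T - S) \<le> real (card (T - S)) * c"
      by (intro sum_bounded_above)
    ultimately show ?thesis unfolding card' by linarith
  qed
  moreover have "sum ?u T = sum ?u (T - S) + sum ?u (S \<inter> T)"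
    using sum.Int_Diff[OF fin(2), of ?u S] by (simp only: Int_commute add.commute)
  moreover have "sum ?u S = sum ?u (S - T) + sum ?u (S \<inter> T)"
    using sum.Int_Diff[OF fin(1), of ?u T] by (simp only: add.commute)
  ultimately show ?thesis by linarith
qed

text \<open>This removes the arbitrary choice among ties: as a maximum of finitely many sums, the
  welfare is seen to be measurable.\<close>

lemma SW_eq_Max:
  assumes "0 \<le> q" "q \<le> 1"
  shows "SW n q x y = (1 / real n) *
    Max ((\<lambda>S. \<Sum>i\<in>S. 1 - \<bar>x i - y\<bar>) ` {S. S \<subseteq> {..<n} \<and> card S = nat \<lfloor>q * real n\<rfloor>})"
proof -
  let ?S = "SOME S. S \<in> accommodated n q x y"
  have S: "?S \<in> accommodated n q x y" by (rule some_accommodated[OF assms])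
  have "finite {S. S \<subseteq> {..<n} \<and> card S = nat \<lfloor>q * real n\<rfloor>}"
    by (rule finite_subset[of _ "Pow {..<n}"]) auto
  then have "Max ((\<lambda>S. \<Sum>i\<in>S. 1 - \<bar>x i - y\<bar>) ` {S. S \<subseteq> {..<n} \<and> card S = nat \<lfloor>q * real n\<rfloor>})
      = (\<Sum>i\<in>?S. 1 - \<bar>x i - y\<bar>)"
    using accommodated_sum_maximal[OF S] S
    by (intro Max_eqI) (auto simp: accommodated_def)
  then show ?thesis by (simp add: SW_def)
qed

text \<open>The agents served at \<open>y\<close> lose at most \<open>\<bar>y - y'\<bar>\<close>
  each when served from \<open>y'\<close>, and the set chosen at \<open>y'\<close> does at least as
  well as they then do.\<close>

lemma SW_le_SW_add_dist:
  assumes "0 \<le> q" "q \<le> 1"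
  shows "SW n q x y \<le> SW n q x y' + \<bar>y - y'\<bar>"
proof (cases "n = 0")
  case False
  let ?S = "SOME S. S \<in> accommodated n q x y" and ?S' = "SOME S. S \<in> accommodated n q x y'"
  have S: "?S \<in> accommodated n q x y" and S': "?S' \<in> accommodated n q x y'"
    using some_accommodated[OF assms] by auto
  have "card ?S \<le> n" using S card_mono[of "{..<n}" ?S] by (auto simp: accommodated_def)
  have "(\<Sum>i\<in>?S. 1 - \<bar>x i - y\<bar>) \<le> (\<Sum>i\<in>?S. (1 - \<bar>x i - y'\<bar>) + \<bar>y - y'\<bar>)"
    by (intro sum_mono) linarith
  also have "\<dots> = (\<Sum>i\<in>?S. 1 - \<bar>x i - y'\<bar>) + real (card ?S) * \<bar>y - y'\<bar>"
    by (simp add: sum.distrib)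
  also have "\<dots> \<le> (\<Sum>i\<in>?S'. 1 - \<bar>x i - y'\<bar>) + real n * \<bar>y - y'\<bar>"
    using accommodated_sum_maximal[OF S', of ?S] S \<open>card ?S \<le> n\<close>
    by (intro add_mono mult_right_mono) (auto simp: accommodated_def)
  finally show ?thesis
    using False by (simp add: SW_def field_simps)
qed (simp add: SW_def)

text \<open>The accommodated agents and the agents in the ball form nested sets, and utilities lie
  in \<open>[0, 1]\<close>, so the sums differ by at most the difference of the
  cardinalities.\<close>

lemma abs_SW_diff_ball_sum_le:
  assumes "0 \<le> q" "q \<le> 1" and "y \<in> {0..1}" and x: "\<And>i. i < n \<Longrightarrow> x i \<in> {0..1}"
  shows "\<bar>SW n q x y - (1 / real n) * (\<Sum>i | i < n \<and> \<bar>x i - y\<bar> \<le> R. 1 - \<bar>x i - y\<bar>)\<bar>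
    \<le> \<bar>real (card {i. i < n \<and> \<bar>x i - y\<bar> \<le> R}) - real (nat \<lfloor>q * real n\<rfloor>)\<bar> / real n"
proof -
  let ?u = "\<lambda>i. 1 - \<bar>x i - y\<bar>"
  define S where "S = (SOME S. S \<in> accommodated n q x y)"
  define T where "T = {i. i < n \<and> \<bar>x i - y\<bar> \<le> R}"
  have S: "S \<in> accommodated n q x y"
    unfolding S_def by (rule some_accommodated) fact+
  then have "S \<subseteq> {..<n}" and card: "card S = nat \<lfloor>q * real n\<rfloor>" by (auto simp: accommodated_def)
  have "T \<subseteq> {..<n}" by (auto simp: T_def)
  have diff: "\<bar>sum ?u B - sum ?u A\<bar> \<le> \<bar>real (card B) - real (card A)\<bar>"
    if "A \<subseteq> B" "B \<subseteq> {..<n}" for A B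
  proof -
    have fin: "finite B" using that finite_subset by blast
    have u: "0 \<le> ?u i" "?u i \<le> 1" if "i \<in> B" for i
      using x[of i] that \<open>B \<subseteq> _\<close> \<open>y \<in> _\<close> by (auto simp: abs_le_iff)
    have "sum ?u B - sum ?u A = sum ?u (B - A)" using that fin by (simp add: sum_diff)
    moreover have "0 \<le> sum ?u (B - A)" using u by (intro sum_nonneg) auto
    moreover have "sum ?u (B - A) \<le> real (card (B - A))"
      using sum_bounded_above[of "B - A" ?u 1] u by simp
    moreover have "real (card (B - A)) = real (card B) - real (card A)"
      using that fin finite_subset[of A B] card_mono[of B A] by (simp add: card_Diff_subset of_nat_diff)
    ultimately show ?thesis by linarith
  qed
  \<comment> \<open>An agent of \<open>S\<close> outside the ball would be farther from
    \<open>y\<close> than an agent of the ball left out of \<open>S\<close>.\<close>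
  have "S \<subseteq> T \<or> T \<subseteq> S"
  proof (rule ccontr)
    assume "\<not> ?thesis"
    then obtain i j where "i \<in> S" "i \<notin> T" "j \<in> T" "j \<notin> S" by auto
    then show False
      using S \<open>S \<subseteq> {..<n}\<close> by (force simp: accommodated_def T_def)
  qed
  then have "\<bar>sum ?u S - sum ?u T\<bar> \<le> \<bar>real (card T) - real (card S)\<bar>"
    using diff[of S T] diff[of T S] \<open>S \<subseteq> {..<n}\<close> \<open>T \<subseteq> {..<n}\<close> by (auto simp: abs_minus_commute)
  then have "\<bar>sum ?u S - sum ?u T\<bar> / real n \<le> \<bar>real (card T) - real (card S)\<bar> / real n"
    by (rule divide_right_mono) simp
  moreover have "\<bar>SW n q x y - (1 / real n) * sum ?u T\<bar> = \<bar>sum ?u S - sum ?u T\<bar> / real n"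
    by (simp add: SW_def S_def[symmetric] diff_divide_distrib[symmetric])
  ultimately show ?thesis by (simp add: T_def[symmetric] card)
qed

section \<open>Order statistics and sample percentiles\<close>

lemma sort_nth_le_iff:
  fixes x :: "nat \<Rightarrow> real"
  assumes "j < n"
  shows "sort (map x [0..<n]) ! j \<le> t \<longleftrightarrow> j < card {i. i < n \<and> x i \<le> t}"
proof -
  define ys where "ys = sort (map x [0..<n])"
  have len: "length ys = n" and sorted: "sorted ys" by (auto simp: ys_def)
  \<comment> \<open>The count is invariant under sorting, and in the sorted list the counted indices
    form an initial segment.\<close>
  have "card {i. i < n \<and> x i \<le> t} = length (filter (\<lambda>z. z \<le> t) (map x [0..<n]))"
    by (simp add: length_filter_conv_card cong: conj_cong)
  also have "\<dots> = length (filter (\<lambda>z. z \<le> t) ys)"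
    by (metis mset_filter mset_sort size_mset ys_def)
  also have "\<dots> = card {i. i < n \<and> ys ! i \<le> t}"
    by (simp add: length_filter_conv_card len)
  finally have card: "card {i. i < n \<and> x i \<le> t} = card {i. i < n \<and> ys ! i \<le> t}" .
  show ?thesis
  proof (cases "ys ! j \<le> t")
    case True
    then have "{..j} \<subseteq> {i. i < n \<and> ys ! i \<le> t}"
      using sorted_nth_mono[OF sorted] assms len by fastforce
    from card_mono[OF _ this] True show ?thesis by (simp add: card ys_def[symmetric])
  next
    case False
    then have "{i. i < n \<and> ys ! i \<le> t} \<subseteq> {..<j}"
      using sorted_nth_mono[OF sorted, of j] assms len by (force simp: not_le)
    from card_mono[OF _ this] False show ?thesis by (simp add: card ys_def[symmetric])
  qed
qed

text \<open>With \<open>j\<close> the zero-based index, the last bound uses the rank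
  \<open>j + 1\<close>: passing to the rank covers the rounding, and the \<open>- 1\<close> on the
  left covers the offset \<open>p\<close>.\<close>

lemma percentile_index:
  assumes "0 \<le> p" "p \<le> 1" "0 < n"
  shows "nat \<lfloor>p * (real n - 1)\<rfloor> < n" "real (nat \<lfloor>p * (real n - 1)\<rfloor>) \<le> p * real n"
    "p * real n - 1 \<le> real (nat \<lfloor>p * (real n - 1)\<rfloor>) + 1"
proof -
  have n: "real n - 1 \<ge> 0" using assms by simp
  have "0 \<le> p * (real n - 1)" "p * (real n - 1) \<le> real n - 1"
    using assms n by (auto simp: mult_left_le_one_le simp del: right_diff_distrib)
  moreover have "p * (real n - 1) = p * real n - p" by (simp add: algebra_simps)
  ultimately show "nat \<lfloor>p * (real n - 1)\<rfloor> < n" "real (nat \<lfloor>p * (real n - 1)\<rfloor>) \<le> p * real n"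
    "p * real n - 1 \<le> real (nat \<lfloor>p * (real n - 1)\<rfloor>) + 1"
    using assms by linarith+
qed

lemma PM_le_iff:
  assumes "0 \<le> p" "p \<le> 1" "0 < n"
  shows "PM p n x \<le> t \<longleftrightarrow> nat \<lfloor>p * (real n - 1)\<rfloor> < card {i. i < n \<and> x i \<le> t}"
  unfolding PM_def by (rule sort_nth_le_iff[OF percentile_index(1)[OF assms]])

lemma PM_mem:
  assumes "0 \<le> p" "p \<le> 1" "0 < n" and x: "\<And>i. i < n \<Longrightarrow> x i \<in> A"
  shows "PM p n x \<in> A"
proof -
  have "PM p n x \<in> set (sort (map x [0..<n]))"
    unfolding PM_def using percentile_index(1)[OF assms(1-3)] by (intro nth_mem) simp
  then show ?thesis using x by auto
qed

lemma card_eq_sum_indicator: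
  fixes n :: nat
  shows "real (card {i. i < n \<and> x i \<in> A}) = (\<Sum>i<n. indicator A (x i))"
proof -
  have "{i. i < n \<and> x i \<in> A} = {..<n} \<inter> {i. x i \<in> A}" by auto
  then show ?thesis
    using sum.inter_restrict[of "{..<n}" "\<lambda>_. 1::real" "{i. x i \<in> A}", OF finite_lessThan]
    by (simp add: indicator_def of_bool_def)
qed

text \<open>The sample percentile is far from \<open>y0\<close> only if the empirical distribution function at one of
  the levels \<open>y0 - e\<close>, \<open>y0 + e\<close> (here \<open>C0 / n\<close>, \<open>C1 / n\<close>) is far from its expected value.\<close>
lemma abs_PM_diff_le:
  assumes p: "0 \<le> p" "p \<le> 1" "0 < n" and "y0 \<in> {0..1}" and x: "\<And>i. i < n \<Longrightarrow> x i \<in> {0..1}"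
    and "0 < e" and m: "m0 < p" "p < m1"
    and C0: "C0 = real (card {i. i < n \<and> x i \<le> y0 - e})"
    and C1: "C1 = real (card {i. i < n \<and> x i \<le> y0 + e})"
  shows "\<bar>PM p n x - y0\<bar> \<le> e + (\<bar>C0 / real n - m0\<bar> + 1 / real n) / (p - m0) + \<bar>C1 / real n - m1\<bar> / (m1 - p)"
proof -
  have "PM p n x \<in> {0..1}" using PM_mem p x by blast
  with \<open>y0 \<in> _\<close> have le1: "\<bar>PM p n x - y0\<bar> \<le> 1" by (auto simp: abs_le_iff)
  have nonneg: "0 \<le> (\<bar>C0 / real n - m0\<bar> + 1 / real n) / (p - m0)" "0 \<le> \<bar>C1 / real n - m1\<bar> / (m1 - p)"
    using m by auto
  \<comment> \<open>In the last two cases one of the quotients is at least 1, which suffices because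
    both points lie in the unit interval.\<close>
  consider "\<bar>PM p n x - y0\<bar> \<le> e" | "PM p n x \<le> y0 - e" | "\<not> PM p n x \<le> y0 + e" by linarith
  then show ?thesis
  proof cases
    case 1
    then show ?thesis using nonneg by linarith
  next
    case 2
    then have "p * real n - 1 \<le> C0"
      using percentile_index(3)[OF p] unfolding PM_le_iff[OF p] C0 by linarith
    then have "(p * real n - 1) / real n \<le> C0 / real n" by (rule divide_right_mono) simp
    then have "p - m0 \<le> \<bar>C0 / real n - m0\<bar> + 1 / real n"
      using p by (simp add: diff_divide_distrib)
    then have "1 \<le> (\<bar>C0 / real n - m0\<bar> + 1 / real n) / (p - m0)"
      using m by simp
    then show ?thesis using le1 nonneg \<open>0 < e\<close> by linarith
  next
    case 3
    then have "C1 \<le> p * real n"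
      using percentile_index(2)[OF p] unfolding PM_le_iff[OF p] C1 by linarith
    then have "C1 / real n \<le> p * real n / real n" by (rule divide_right_mono) simp
    then have "m1 - p \<le> \<bar>C1 / real n - m1\<bar>"
      using p by simp
    then have "1 \<le> \<bar>C1 / real n - m1\<bar> / (m1 - p)"
      using m by simp
    then show ?thesis using le1 nonneg \<open>0 < e\<close> by linarith
  qed
qed

section \<open>Expected welfare of percentile mechanisms\<close>

lemma (in prob_space) integral_PiM_component:
  fixes g :: "'a \<Rightarrow> real"
  assumes "i \<in> I" and [measurable]: "g \<in> borel_measurable M"
  shows "(\<integral>x. g (x i) \<partial>PiM I (\<lambda>_. M)) = (\<integral>z. g z \<partial>M)"
proof -
  have "distr (PiM I (\<lambda>_. M)) M (\<lambda>x. x i) = M"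
    by (rule distr_PiM_component[of I "\<lambda>_. M", OF prob_space_axioms \<open>i \<in> I\<close>])
  then have "(\<integral>z. g z \<partial>M) = (\<integral>z. g z \<partial>distr (PiM I (\<lambda>_. M)) M (\<lambda>x. x i))" by simp
  also have "\<dots> = (\<integral>x. g (x i) \<partial>PiM I (\<lambda>_. M))"
    using assms by (intro integral_distr) auto
  finally show ?thesis ..
qed

text \<open>In the expanded square the \<open>n\<close> diagonal terms have mean at most 1; off the
  diagonal, independence makes the mean a product with a zero factor.\<close>

lemma (in prob_space) integral_PiM_sum_square_le:
  fixes g :: "'a \<Rightarrow> real"
  assumes [measurable]: "g \<in> borel_measurable M"
    and bound: "\<And>z. \<bar>g z\<bar> \<le> 1" and mean: "(\<integral>z. g z \<partial>M) = 0"
  shows "(\<integral>x. (\<Sum>i<n. g (x i))\<^sup>2 \<partial>PiM {..<n} (\<lambda>_. M)) \<le> real n"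
proof -
  interpret P: prob_space "PiM {..<n} (\<lambda>_. M)"
    by (intro prob_space_PiM prob_space_axioms)
  interpret S: product_sigma_finite "\<lambda>_. M"
    by (intro product_sigma_finite.intro sigma_finite_measure_axioms)
  have bound2: "\<bar>g z * g w\<bar> \<le> 1" for z w
    using bound[of z] bound[of w] by (simp add: abs_mult mult_le_one)
  have int: "integrable (PiM {..<n} (\<lambda>_. M)) (\<lambda>x. g (x i) * g (x j))" if "i < n" "j < n" for i j
    using that bound2 by (intro P.integrable_const_bound[of _ 1]) auto
  have le: "(\<integral>x. g (x i) * g (x j) \<partial>PiM {..<n} (\<lambda>_. M)) \<le> (if j = i then 1 else 0)"
    if ij: "i < n" "j < n" for i j
  proof (cases "i = j")
    case True
    then show ?thesis
      using ij bound2 by (auto intro!: P.integral_le_const int simp: abs_le_iff)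
  next
    case False
    \<comment> \<open>Padding with factors 1 turns \<open>g (x i) * g (x j)\<close> into a product
      over all coordinates, to which the product rule for integrals applies.\<close>
    define F where "F k z = (if k = i then g z else 1) * (if k = j then g z else 1)" for k z
    have F_int: "integrable M (F k)" for k
      unfolding F_def by (intro integrable_const_bound[of _ 1] AE_I2) (use bound bound2 in \<open>auto simp: abs_le_iff minus_le_iff\<close>)
    have "g (x i) * g (x j) = (\<Prod>k<n. F k (x k))" for x
      using ij by (simp add: F_def prod.distrib)
    then have "(\<integral>x. g (x i) * g (x j) \<partial>PiM {..<n} (\<lambda>_. M)) = (\<Prod>k<n. \<integral>z. F k z \<partial>M)"
      using S.product_integral_prod[of "{..<n}" F] F_int by simp
    also have "\<dots> = 0"
      using ij False mean by (intro prod_zero) (auto intro!: bexI[of _ i] simp: F_def)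
    finally show ?thesis using False by simp
  qed
  have "(\<integral>x. (\<Sum>i<n. g (x i))\<^sup>2 \<partial>PiM {..<n} (\<lambda>_. M))
      = (\<Sum>i<n. \<Sum>j<n. \<integral>x. g (x i) * g (x j) \<partial>PiM {..<n} (\<lambda>_. M))"
    unfolding power2_eq_square sum_product using int
    by (subst Bochner_Integration.integral_sum; (intro sum.cong refl)?)
      (auto intro!: Bochner_Integration.integrable_sum)
  also have "\<dots> \<le> (\<Sum>i<n. \<Sum>j<n. if j = i then 1 else 0)"
    using le by (intro sum_mono) auto
  also have "\<dots> = real n" by simp
  finally show ?thesis .
qed

text \<open>The second moment of the centred count controls its mean absolute value, by a weighted
  arithmetic-geometric mean inequality in place of Cauchy-Schwarz.\<close>

lemma (in prob_space) empirical_measure_L1_error: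
  assumes [measurable]: "B \<in> sets M" and "0 < n"
  shows "(\<integral>x. \<bar>(\<Sum>i<n. indicator B (x i)) / real n - measure M B\<bar> \<partial>PiM {..<n} (\<lambda>_. M))
    \<le> 1 / sqrt (real n)"
proof -
  interpret P: prob_space "PiM {..<n} (\<lambda>_. M)"
    by (intro prob_space_PiM prob_space_axioms)
  define g :: "'a \<Rightarrow> real" where "g z = indicator B z - measure M B" for z
  define Z where "Z x = (\<Sum>i<n. g (x i))" for x
  have [measurable]: "g \<in> borel_measurable M" unfolding g_def by measurable
  have bound: "\<bar>g z\<bar> \<le> 1" for z
    using prob_le_1[of B] by (auto simp: g_def indicator_def)
  have mean: "(\<integral>z. g z \<partial>M) = 0"
    unfolding g_def by (subst Bochner_Integration.integral_diff) (auto simp: prob_space intro: integrable_const_bound[of _ 1])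
  have Zn: "\<bar>Z x\<bar> \<le> real n" for x
    unfolding Z_def using sum_norm_bound[of "{..<n}" "\<lambda>i. g (x i)" 1] bound by simp
  have Zm[measurable]: "Z \<in> borel_measurable (PiM {..<n} (\<lambda>_. M))"
    unfolding Z_def by measurable
  have int2: "integrable (PiM {..<n} (\<lambda>_. M)) (\<lambda>x. (Z x)\<^sup>2)"
    using abs_le_square_iff[of "Z _" "real n"] Zn by (intro P.integrable_const_bound[of _ "(real n)\<^sup>2"]) auto
  define s where "s = sqrt (real n)"
  have s: "0 < s" "real n = s\<^sup>2" using \<open>0 < n\<close> by (auto simp: s_def)
  \<comment> \<open>This expands a nonnegative square. The weights are chosen so that both summands
    have mean at most \<open>1 / s\<close>, as the second moment of \<open>Z\<close> is at most
    \<open>s\<^sup>2\<close>.\<close>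
  have amgm: "\<bar>Z x / real n\<bar> \<le> ((Z x)\<^sup>2 / s ^ 3 + 1 / s) / 2" for x
  proof -
    have "0 \<le> (\<bar>Z x\<bar> - s)\<^sup>2 / s ^ 3" using s by simp
    also have "\<dots> = (\<bar>Z x\<bar>\<^sup>2 / s ^ 3 + 1 / s) - 2 * (\<bar>Z x\<bar> / s\<^sup>2)"
      using s(1) by (simp add: field_simps power2_eq_square power3_eq_cube)
    also have "\<dots> = ((Z x)\<^sup>2 / s ^ 3 + 1 / s) - 2 * \<bar>Z x / real n\<bar>"
      unfolding s(2) by (simp add: abs_divide)
    finally show ?thesis by (simp add: mult.commute)
  qed
  have "(\<Sum>i<n. indicator B (x i)) / real n - measure M B = Z x / real n" for x
    using \<open>0 < n\<close> by (simp add: Z_def g_def sum_subtractf diff_divide_distrib)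
  then have "(\<integral>x. \<bar>(\<Sum>i<n. indicator B (x i)) / real n - measure M B\<bar> \<partial>PiM {..<n} (\<lambda>_. M))
      = (\<integral>x. \<bar>Z x / real n\<bar> \<partial>PiM {..<n} (\<lambda>_. M))" by simp
  also have "\<dots> \<le> (\<integral>x. ((Z x)\<^sup>2 / s ^ 3 + 1 / s) / 2 \<partial>PiM {..<n} (\<lambda>_. M))"
  proof (rule integral_mono)
    show "integrable (PiM {..<n} (\<lambda>_. M)) (\<lambda>x. \<bar>Z x / real n\<bar>)"
      using Zn \<open>0 < n\<close> by (intro P.integrable_const_bound[of _ 1]) (auto simp: abs_divide)
    show "integrable (PiM {..<n} (\<lambda>_. M)) (\<lambda>x. ((Z x)\<^sup>2 / s ^ 3 + 1 / s) / 2)"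
      using int2 by auto
  qed (rule amgm)
  also have "\<dots> = ((\<integral>x. (Z x)\<^sup>2 \<partial>PiM {..<n} (\<lambda>_. M)) / s ^ 3 + 1 / s) / 2"
    using int2 by (simp add: P.prob_space)
  also have "\<dots> \<le> (real n / s ^ 3 + 1 / s) / 2"
    using integral_PiM_sum_square_le[OF _ bound mean, of n] s
    by (intro divide_right_mono add_right_mono) (auto simp: Z_def)
  also have "\<dots> = 1 / s" using s by (simp add: power2_eq_square power3_eq_cube)
  finally show ?thesis by (simp add: s_def)
qed

section \<open>Measurability and convergence of the expected welfare\<close>

lemma measurable_PM:
  assumes "0 \<le> p" "p \<le> 1" "0 < n" and [measurable_cong]: "sets M = sets borel"
  shows "(\<lambda>x. PM p n x) \<in> borel_measurable (PiM {..<n} (\<lambda>_. M))"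
  unfolding borel_measurable_iff_le
proof
  fix t
  let ?j = "nat \<lfloor>p * (real n - 1)\<rfloor>"
  have "{x \<in> space (PiM {..<n} (\<lambda>_. M)). PM p n x \<le> t}
      = {x \<in> space (PiM {..<n} (\<lambda>_. M)). real ?j < (\<Sum>i<n. indicator {..t} (x i))}"
    unfolding PM_le_iff[OF assms(1-3)] card_eq_sum_indicator[of n _ "{..t}", symmetric]
      of_nat_less_iff atMost_iff ..
  also have "\<dots> \<in> sets (PiM {..<n} (\<lambda>_. M))" by measurable
  finally show "{x \<in> space (PiM {..<n} (\<lambda>_. M)). PM p n x \<le> t} \<in> sets (PiM {..<n} (\<lambda>_. M))" .
qed

lemma measurable_SW:
  assumes "0 \<le> q" "q \<le> 1" and [measurable_cong]: "sets M = sets borel"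
    and [measurable]: "Y \<in> borel_measurable (PiM {..<n} (\<lambda>_. M))"
  shows "(\<lambda>x. SW n q x (Y x)) \<in> borel_measurable (PiM {..<n} (\<lambda>_. M))"
proof -
  let ?F = "{S. S \<subseteq> {..<n} \<and> card S = nat \<lfloor>q * real n\<rfloor>}"
  have "finite ?F" by (rule finite_subset[of _ "Pow {..<n}"]) auto
  moreover have "(\<lambda>x. \<Sum>i\<in>S. 1 - \<bar>x i - Y x\<bar>) \<in> borel_measurable (PiM {..<n} (\<lambda>_. M))"
    if "S \<in> ?F" for S
    using that by (intro borel_measurable_sum) auto
  ultimately show ?thesis
    unfolding SW_eq_Max[OF assms(1,2)]
    by (intro borel_measurable_times borel_measurable_const borel_measurable_Max)
qed

lemma floor_capacity_error:
  assumes "0 \<le> q" "0 < n"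
  shows "\<bar>real (nat \<lfloor>q * real n\<rfloor>) / real n - q\<bar> \<le> 1 / real n"
proof -
  have "0 \<le> q * real n" using assms by simp
  then have "\<bar>real (nat \<lfloor>q * real n\<rfloor>) - q * real n\<bar> \<le> 1" by linarith
  then have "\<bar>real (nat \<lfloor>q * real n\<rfloor>) - q * real n\<bar> / real n \<le> 1 / real n"
    by (rule divide_right_mono) simp
  moreover have "\<bar>real (nat \<lfloor>q * real n\<rfloor>) - q * real n\<bar> / real n = \<bar>real (nat \<lfloor>q * real n\<rfloor>) / real n - q\<bar>"
  proof -
    have "real (nat \<lfloor>q * real n\<rfloor>) / real n - q = (real (nat \<lfloor>q * real n\<rfloor>) - q * real n) / real n"
      using assms by (simp add: diff_divide_distrib)
    then show ?thesis by (simp add: abs_divide)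
  qed
  ultimately show ?thesis by simp
qed

text \<open>The percentile is replaced by \<open>y0\<close> through the Lipschitz bound, then the
  accommodated set by the ball. Each of the three empirical measures involved deviates by at most
  \<open>1 / sqrt n\<close> in mean.\<close>

lemma expected_SW_PM_error:
  fixes M :: "real measure" and y0 q p R e :: real
  assumes "prob_space M" and sets[measurable_cong]: "sets M = sets borel" and supp: "AE z in M. z \<in> {0..1}"
    and q: "0 \<le> q" "q \<le> 1" and p: "0 \<le> p" "p \<le> 1" and y0: "y0 \<in> {0..1}" and "0 < n" "0 < e"
    and ball: "measure M {y0 - R..y0 + R} = q"
    and m0: "measure M {..y0 - e} < p" and m1: "p < measure M {..y0 + e}"
  defines "d0 \<equiv> p - measure M {..y0 - e}" and "d1 \<equiv> measure M {..y0 + e} - p"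
  shows "\<bar>(\<integral>x. SW n q x (PM p n x) \<partial>PiM {..<n} (\<lambda>_. M))
      - (\<integral>z\<in>{y0 - R..y0 + R}. 1 - \<bar>z - y0\<bar> \<partial>M)\<bar>
    \<le> e + (1 / d0 + 1 / d1 + 1) / sqrt (real n) + (1 / d0 + 1) / real n"
proof -
  let ?P = "PiM {..<n} (\<lambda>_. M)"
  interpret prob_space M by fact
  interpret P: prob_space ?P
    by (intro prob_space_PiM prob_space_axioms)
  define B where "B = {y0 - R..y0 + R}"
  define g where "g z = indicator B z * (1 - \<bar>z - y0\<bar>)" for z
  define dev where "dev A x = \<bar>(\<Sum>i<n. indicator A (x i)) / real n - measure M A\<bar>" for A :: "real set" and x :: "nat \<Rightarrow> real"
  \<comment> \<open>The terms up to the one with \<open>d1\<close> bound the displacement of the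
    percentile; the last bracket bounds the gap between the ball count and the rounded
    capacity.\<close>
  define bound where "bound x = e + (dev {..y0 - e} x + 1 / real n) / d0 + dev {..y0 + e} x / d1
    + (dev B x + 1 / real n)" for x
  have d: "0 < d0" "0 < d1" using m0 m1 by (auto simp: d0_def d1_def)
  have [measurable]: "B \<in> sets M" "{..y0 - e} \<in> sets M" "{..y0 + e} \<in> sets M"
    by (auto simp: sets B_def)
  have [measurable]: "g \<in> borel_measurable M"
    unfolding g_def by measurable
  have dev_int: "integrable ?P (dev A)" if [measurable]: "A \<in> sets M" for A
  proof (rule P.integrable_const_bound[of _ "1 + measure M A"])
    have "0 \<le> (\<Sum>i<n. indicat_real A (x i)) / real n" "(\<Sum>i<n. indicat_real A (x i)) / real n \<le> 1" for x
      using sum_bounded_above[of "{..<n}" "\<lambda>i. indicat_real A (x i)" 1] \<open>0 < n\<close>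
      by (auto simp: divide_le_eq intro!: divide_nonneg_nonneg sum_nonneg)
    then have "dev A x \<le> 1 + measure M A" "0 \<le> dev A x" for x
      using measure_nonneg[of M A] unfolding dev_def by (auto simp: abs_le_iff add_increasing add_increasing2)
    then show "AE x in ?P. norm (dev A x) \<le> 1 + measure M A" by simp
    show "dev A \<in> borel_measurable ?P" unfolding dev_def by measurable
  qed
  have dev_le: "(\<integral>x. dev A x \<partial>?P) \<le> 1 / sqrt (real n)" if "A \<in> sets M" for A
    unfolding dev_def by (rule empirical_measure_L1_error[OF that \<open>0 < n\<close>])
  have AE_x: "AE x in ?P. \<forall>i\<in>{..<n}. x i \<in> {0..1}"
    by (intro AE_finite_allI AE_PiM_component prob_space_axioms supp) auto
  have SWm[measurable]: "(\<lambda>x. SW n q x (PM p n x)) \<in> borel_measurable ?P"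
    by (intro measurable_SW measurable_PM q p sets \<open>0 < n\<close>)
  \<comment> \<open>The subtracted average has exactly the mean of \<open>g\<close>, so it remains
    to bound the mean of \<open>\<bar>h x\<bar>\<close>.\<close>
  define h where "h x = SW n q x (PM p n x) - (1 / real n) * (\<Sum>i<n. g (x i))" for x
  have h_le: "\<bar>h x\<bar> \<le> bound x" if "\<forall>i\<in>{..<n}. x i \<in> {0..1}" for x
  proof -
    have x: "x i \<in> {0..1}" if "i < n" for i using that \<open>\<forall>i\<in>{..<n}. x i \<in> {0..1}\<close> by auto
    have B: "x i \<in> B \<longleftrightarrow> \<bar>x i - y0\<bar> \<le> R" for i by (auto simp: B_def abs_le_iff)
    have card: "real (card {i. i < n \<and> \<bar>x i - y0\<bar> \<le> R}) = (\<Sum>i<n. indicator B (x i))"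
      using card_eq_sum_indicator[of n x B] by (simp add: B)
    have sum: "(\<Sum>i<n. g (x i)) = (\<Sum>i | i < n \<and> \<bar>x i - y0\<bar> \<le> R. 1 - \<bar>x i - y0\<bar>)"
      unfolding g_def B[symmetric]
      by (rule sum.mono_neutral_cong_right) (auto simp: indicator_def)
    have "\<bar>SW n q x (PM p n x) - SW n q x y0\<bar> \<le> \<bar>PM p n x - y0\<bar>"
      using SW_le_SW_add_dist[OF q, of n x "PM p n x" y0] SW_le_SW_add_dist[OF q, of n x y0 "PM p n x"]
      by linarith
    also have "\<dots> \<le> e + (dev {..y0 - e} x + 1 / real n) / d0 + dev {..y0 + e} x / d1"
      unfolding d0_def d1_def dev_def
      using card_eq_sum_indicator[of n x "{..y0 - e}"] card_eq_sum_indicator[of n x "{..y0 + e}"]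
      by (intro abs_PM_diff_le p \<open>0 < n\<close> y0 x \<open>0 < e\<close> m0 m1) auto
    finally have 1: "\<bar>SW n q x (PM p n x) - SW n q x y0\<bar>
      \<le> e + (dev {..y0 - e} x + 1 / real n) / d0 + dev {..y0 + e} x / d1" .
    have "\<bar>SW n q x y0 - (1 / real n) * (\<Sum>i<n. g (x i))\<bar>
        \<le> \<bar>(\<Sum>i<n. indicator B (x i)) - real (nat \<lfloor>q * real n\<rfloor>)\<bar> / real n"
      unfolding sum using abs_SW_diff_ball_sum_le[OF q y0, of n x R] x card by simp
    also have "\<dots> = \<bar>(\<Sum>i<n. indicator B (x i)) / real n - real (nat \<lfloor>q * real n\<rfloor>) / real n\<bar>"
      by (simp add: diff_divide_distrib[symmetric])
    also have "\<dots> \<le> dev B x + 1 / real n"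
      using floor_capacity_error[OF q(1) \<open>0 < n\<close>] ball unfolding dev_def B_def by linarith
    finally show ?thesis using 1 unfolding h_def bound_def by linarith
  qed
  have bound_int: "integrable ?P bound"
    unfolding bound_def using dev_int by auto
  have h_int: "integrable ?P h"
  proof (rule Bochner_Integration.integrable_bound[OF bound_int])
    show "AE x in ?P. norm (h x) \<le> norm (bound x)"
      using AE_x
    proof eventually_elim
      case (elim x)
      from h_le[OF elim] show ?case by simp
    qed
    show "h \<in> borel_measurable ?P" unfolding h_def by measurable
  qed
  have g_le: "\<bar>g z\<bar> \<le> 1" if "z \<in> {0..1}" for z
    using that y0 by (auto simp: g_def indicator_def abs_le_iff)
  have g_int: "integrable ?P (\<lambda>x. g (x i))" if "i < n" for i
  proof (rule P.integrable_const_bound[of _ 1])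
    show "AE x in ?P. norm (g (x i)) \<le> 1"
      using AE_x by eventually_elim (use g_le that in simp)
    have [measurable]: "i \<in> {..<n}" using that by simp
    show "(\<lambda>x. g (x i)) \<in> borel_measurable ?P" by measurable
  qed
  have sum_int: "integrable ?P (\<lambda>x. (1 / real n) * (\<Sum>i<n. g (x i)))"
    by (intro integrable_mult_right Bochner_Integration.integrable_sum) (use g_int in auto)
  have mean: "(\<integral>x. (1 / real n) * (\<Sum>i<n. g (x i)) \<partial>?P) = (\<integral>z. g z \<partial>M)"
    using g_int \<open>0 < n\<close> integral_PiM_component[of _ "{..<n}" g]
    by (simp add: Bochner_Integration.integral_sum)
  have "(\<lambda>x. SW n q x (PM p n x)) = (\<lambda>x. h x + (1 / real n) * (\<Sum>i<n. g (x i)))"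
    by (simp add: h_def)
  then have "(\<integral>x. SW n q x (PM p n x) \<partial>?P) - (\<integral>z. g z \<partial>M) = (\<integral>x. h x \<partial>?P)"
    using h_int sum_int mean by simp
  also have "\<bar>\<dots>\<bar> \<le> (\<integral>x. \<bar>h x\<bar> \<partial>?P)" by (rule integral_abs_bound)
  also have "\<dots> \<le> (\<integral>x. bound x \<partial>?P)"
    using AE_x h_int bound_int by (intro integral_mono_AE) (auto elim!: eventually_mono intro: h_le)
  also have "\<dots> = e + ((\<integral>x. dev {..y0 - e} x \<partial>?P) + 1 / real n) / d0 + (\<integral>x. dev {..y0 + e} x \<partial>?P) / d1
      + ((\<integral>x. dev B x \<partial>?P) + 1 / real n)"
    unfolding bound_def using dev_int by (simp add: P.prob_space)
  also have "\<dots> \<le> e + (1 / sqrt (real n) + 1 / real n) / d0 + (1 / sqrt (real n)) / d1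
      + (1 / sqrt (real n) + 1 / real n)"
    using dev_le d by (intro add_mono divide_right_mono order.refl) auto
  also have "\<dots> = e + (1 / d0 + 1 / d1 + 1) / sqrt (real n) + (1 / d0 + 1) / real n"
    by (simp add: add_divide_distrib mult.commute)
  finally show ?thesis
    by (simp add: set_lebesgue_integral_def g_def[abs_def] B_def)
qed

text \<open>The last two hypotheses say that the distribution function crosses the level
  \<open>p\<close> strictly at \<open>y0\<close>, so \<open>d0\<close> and \<open>d1\<close> are
  positive. For \<open>e = r / 2\<close> they do not depend on \<open>n\<close>, and the rest of the
  error vanishes.\<close>

lemma expected_SW_PM_tendsto:
  fixes M :: "real measure" and y0 q p R :: real
  assumes "prob_space M" "sets M = sets borel" "AE z in M. z \<in> {0..1}"
    and "0 \<le> q" "q \<le> 1" "0 \<le> p" "p \<le> 1" "y0 \<in> {0..1}"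
    and "measure M {y0 - R..y0 + R} = q"
    and left: "\<And>t. t < y0 \<Longrightarrow> measure M {..t} < p" and right: "\<And>t. y0 < t \<Longrightarrow> p < measure M {..t}"
  shows "(\<lambda>n. \<integral>x. SW n q x (PM p n x) \<partial>PiM {..<n} (\<lambda>_. M))
    \<longlonglongrightarrow> (\<integral>z\<in>{y0 - R..y0 + R}. 1 - \<bar>z - y0\<bar> \<partial>M)"
proof (rule tendstoI)
  fix r :: real
  assume "0 < r"
  define d0 where "d0 = p - measure M {..y0 - r / 2}"
  define d1 where "d1 = measure M {..y0 + r / 2} - p"
  have "(\<lambda>n. r / 2 + (1 / d0 + 1 / d1 + 1) / sqrt (real n) + (1 / d0 + 1) / real n) \<longlonglongrightarrow> r / 2 + 0 + 0"
    by (intro tendsto_intros tendsto_divide_0[OF tendsto_const] filterlim_at_top_imp_at_infinity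
        filterlim_compose[OF sqrt_at_top] filterlim_real_sequentially)
  then have "\<forall>\<^sub>F n in sequentially. r / 2 + (1 / d0 + 1 / d1 + 1) / sqrt (real n) + (1 / d0 + 1) / real n < r"
    using \<open>0 < r\<close> order_tendstoD(2)[of _ "r / 2" sequentially r] by simp
  with eventually_gt_at_top[of 0]
  show "\<forall>\<^sub>F n in sequentially. dist (\<integral>x. SW n q x (PM p n x) \<partial>PiM {..<n} (\<lambda>_. M))
    (\<integral>z\<in>{y0 - R..y0 + R}. 1 - \<bar>z - y0\<bar> \<partial>M) < r"
  proof eventually_elim
    case (elim n)
    then show ?case
      using expected_SW_PM_error[OF assms(1-8) _ _ assms(9) left right, of n "r / 2"] \<open>0 < r\<close>
      by (simp add: dist_real_def d0_def d1_def)
  qed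
qed

section \<open>Single-dipped densities\<close>

text \<open>The dip is a parameter, and its uniqueness is recorded as positivity of \<open>f\<close>
  elsewhere, which makes the distribution function strictly increasing on the unit interval.\<close>

locale dipped_density =
  fixes f :: "real \<Rightarrow> real" and m :: real
  assumes density: "prob_density f"
    and cont: "continuous_on {0..1} f"
    and m: "m \<in> {0..1}"
    and noninc: "\<And>x y. 0 \<le> x \<Longrightarrow> x \<le> y \<Longrightarrow> y \<le> m \<Longrightarrow> f y \<le> f x"
    and nondec: "\<And>x y. m \<le> x \<Longrightarrow> x \<le> y \<Longrightarrow> y \<le> 1 \<Longrightarrow> f x \<le> f y"
    and pos: "\<And>x. 0 \<le> x \<Longrightarrow> x \<le> 1 \<Longrightarrow> x \<noteq> m \<Longrightarrow> 0 < f x"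
begin

abbreviation \<mu> :: "real measure" where "\<mu> \<equiv> dens_measure f"

lemma nonneg: "0 \<le> x \<Longrightarrow> x \<le> 1 \<Longrightarrow> 0 \<le> f x"
  using density by (simp add: prob_density_def)

lemma measurable_density [measurable]: "(\<lambda>x. indicator {0..1} x * f x) \<in> borel_measurable borel"
  using borel_measurable_continuous_on_indicator[OF _ cont] by simp

lemma sets_dens_measure [simp, measurable_cong]: "sets \<mu> = sets borel"
  by (simp add: dens_measure_def)

lemma space_dens_measure [simp]: "space \<mu> = UNIV"
  by (simp add: dens_measure_def)

lemma AE_unit_interval: "AE x in \<mu>. x \<in> {0..1}"
proof -
  have dens: "(\<lambda>x. ennreal (indicator {0..1} x * f x)) \<in> borel_measurable lborel" by measurable
  show ?thesis
    unfolding dens_measure_def AE_density[OF dens] by (intro AE_I2) (simp add: indicator_def)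
qed

lemma AE_neq: "AE x in \<mu>. x \<noteq> a"
proof -
  have dens: "(\<lambda>x. ennreal (indicator {0..1} x * f x)) \<in> borel_measurable lborel" by measurable
  show ?thesis
    unfolding dens_measure_def AE_density[OF dens] using AE_lborel_singleton[of a] by eventually_elim simp
qed

text \<open>This passes to the gauge integral, whose fundamental theorem of calculus yields the
  derivative of the distribution function.\<close>

lemma emeasure_Icc:
  assumes "0 \<le> a" "a \<le> b" "b \<le> 1"
  shows "emeasure \<mu> {a..b} = ennreal (integral {a..b} f)"
proof -
  have [measurable]: "(\<lambda>x. indicator {a..b} x * f x) \<in> borel_measurable borel"
    using borel_measurable_continuous_on_indicator[OF _ continuous_on_subset[OF cont], of "{a..b}"] assms by simp
  have "f integrable_on {a..b}"
    by (rule integrable_continuous_real, rule continuous_on_subset[OF cont]) (use assms in auto)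
  then have "((\<lambda>x. if x \<in> {a..b} then f x else 0) has_integral integral {a..b} f) UNIV"
    by (simp only: has_integral_restrict_UNIV integrable_integral)
  moreover have "(\<lambda>x. if x \<in> {a..b} then f x else 0) = (\<lambda>x. indicator {a..b} x * f x)"
    by (auto simp: indicator_def)
  ultimately have "(\<integral>\<^sup>+x. ennreal (indicator {a..b} x * f x) \<partial>lborel) = ennreal (integral {a..b} f)"
  proof (intro nn_integral_has_integral_lborel)
    show "0 \<le> indicator {a..b} x * f x" for x using assms by (auto simp: indicator_def nonneg)
  qed simp_all
  moreover have "emeasure \<mu> {a..b} = (\<integral>\<^sup>+x. ennreal (indicator {a..b} x * f x) \<partial>lborel)"
  proof -
    have "emeasure \<mu> {a..b} = (\<integral>\<^sup>+x. ennreal (indicator {0..1} x * f x) * indicator {a..b} x \<partial>lborel)"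
      unfolding dens_measure_def by (rule emeasure_density) measurable
    also have "\<dots> = (\<integral>\<^sup>+x. ennreal (indicator {a..b} x * f x) \<partial>lborel)"
      using assms by (intro nn_integral_cong) (auto simp: indicator_def)
    finally show ?thesis .
  qed
  ultimately show ?thesis by simp
qed

sublocale prob_space \<mu>
proof
  have "emeasure \<mu> (space \<mu>) = emeasure \<mu> {0..1}"
    using AE_unit_interval by (intro emeasure_eq_AE) auto
  then show "emeasure \<mu> (space \<mu>) = 1"
    using emeasure_Icc[of 0 1] density by (simp add: prob_density_def)
qed

lemma integrable_bounded_on_unit:
  fixes g :: "real \<Rightarrow> real"
  assumes "g \<in> borel_measurable borel" and "\<And>x. 0 \<le> x \<Longrightarrow> x \<le> 1 \<Longrightarrow> \<bar>g x\<bar> \<le> C"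
  shows "integrable \<mu> g"
proof (rule integrable_const_bound[of _ C])
  show "AE x in \<mu>. norm (g x) \<le> C"
    using AE_unit_interval by eventually_elim (use assms in auto)
  show "g \<in> borel_measurable \<mu>" using assms by measurable
qed

section \<open>Distribution function\<close>

definition F :: "real \<Rightarrow> real" where "F t = measure \<mu> {..t}"

lemma F_eq_integral:
  assumes "0 \<le> t" "t \<le> 1"
  shows "F t = integral {0..t} f"
proof -
  have "emeasure \<mu> {..t} = emeasure \<mu> {0..t}"
    using AE_unit_interval by (intro emeasure_eq_AE) auto
  moreover have "0 \<le> integral {0..t} f"
    using assms nonneg by (intro Henstock_Kurzweil_Integration.integral_nonneg integrable_continuous_real
        continuous_on_subset[OF cont]) auto
  ultimately show ?thesis
    using emeasure_Icc[of 0 t] assms by (simp add: F_def measure_def)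
qed

lemma F_mono: "s \<le> t \<Longrightarrow> F s \<le> F t"
  unfolding F_def by (intro finite_measure_mono) auto

lemma F_bounds: "0 \<le> F t" "F t \<le> 1"
  by (simp_all add: F_def)

lemma F_1: "F 1 = 1"
  using F_eq_integral[of 1] density by (simp add: prob_density_def)

lemma F_eq_0: "t \<le> 0 \<Longrightarrow> F t = 0"
  using F_mono[of t 0] F_eq_integral[of 0] by (simp add: F_def measure_le_0_iff)

lemma F_eq_1: "1 \<le> t \<Longrightarrow> F t = 1"
  using F_mono[of 1 t] F_1 F_bounds(2)[of t] by simp

lemma DERIV_F:
  assumes "t \<in> {0..1}"
  shows "(F has_real_derivative f t) (at t within {0..1})"
  by (rule has_field_derivative_transform_within[OF integral_has_real_derivative[OF cont assms] zero_less_one assms])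
    (simp add: F_eq_integral)

lemma F_mvt:
  assumes "0 \<le> s" "s < t" "t \<le> 1"
  obtains x where "s < x" "x < t" "F t - F s = (t - s) * f x"
proof -
  have "\<exists>x\<in>{s<..<t}. F t - F s = (\<lambda>d. f x * d) (t - s)"
  proof (rule mvt_simple[OF \<open>s < t\<close>])
    fix x assume "s \<le> x" "x \<le> t"
    then have "(F has_real_derivative f x) (at x within {s..t})"
      using DERIV_F[of x] assms by (auto intro: has_field_derivative_subset)
    then show "(F has_derivative (\<lambda>d. f x * d)) (at x within {s..t})"
      by (simp add: has_field_derivative_def)
  qed
  then show ?thesis using that by (auto simp: mult.commute)
qed

text \<open>The density can vanish only at \<open>m\<close>, and one half of the interval has no
  \<open>m\<close> in its interior.\<close>

lemma F_strict:
  assumes "0 \<le> s" "s < t" "t \<le> 1"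
  shows "F s < F t"
proof -
  have less: "F a < F b" if ab: "s \<le> a" "a < b" "b \<le> t" "m \<notin> {a<..<b}" for a b
  proof -
    obtain x where "a < x" "x < b" "F b - F a = (b - a) * f x"
      using F_mvt[of a b] ab assms by auto
    moreover have "0 < (b - a) * f x"
      using pos[of x] ab assms \<open>a < x\<close> \<open>x < b\<close> by (intro mult_pos_pos) auto
    ultimately show ?thesis by simp
  qed
  define c where "c = (s + t) / 2"
  have c: "s < c" "c < t" using assms by (auto simp: c_def)
  show ?thesis
  proof (cases "m < c")
    case True
    then show ?thesis using less[of c t] F_mono[of s c] c by auto
  next
    case False
    then show ?thesis using less[of s c] F_mono[of c t] c by auto
  qed
qed

text \<open>Balls around a facility may overhang the unit interval, so strictness is needed for all
  intervals that meet its interior.\<close>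

lemma F_strict':
  assumes "s < t" "0 < t" "s < 1"
  shows "F s < F t"
proof -
  have "F s \<le> F (max s 0)" by (rule F_mono) simp
  also have "\<dots> < F (min t 1)" by (rule F_strict) (use assms in auto)
  also have "\<dots> \<le> F t" by (rule F_mono) simp
  finally show ?thesis .
qed

lemma continuous_F: "continuous_on UNIV F"
proof -
  have "F t = F (max 0 (min 1 t))" for t
    using F_eq_0[of t] F_eq_0[of 0] F_eq_1[of t] F_1 by (auto simp: max_def min_def)
  moreover have "continuous_on UNIV (\<lambda>t. F (max 0 (min 1 t)))"
    by (rule continuous_on_compose2[OF DERIV_continuous_on[OF DERIV_F]]) (auto intro!: continuous_intros)
  ultimately show ?thesis by simp
qed

lemma measure_Ioc: "a \<le> b \<Longrightarrow> measure \<mu> {a<..b} = F b - F a"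
proof -
  assume "a \<le> b"
  have "{..b} - {..a} = {a<..b}" by auto
  then show ?thesis
    using finite_measure_Diff[of "{..b}" "{..a}"] \<open>a \<le> b\<close> by (simp add: F_def)
qed

lemma measure_Icc: "a \<le> b \<Longrightarrow> measure \<mu> {a..b} = F b - F a"
  unfolding measure_Ioc[symmetric]
  using AE_neq[of a] by (intro finite_measure_eq_AE) (auto elim: eventually_mono)

text \<open>A ball of radius 1 has full mass, so the intermediate value theorem yields a radius. It
  is unique: if two balls had equal mass, the smaller would already cover the unit interval and have
  mass 1. Hence the infimum is over a singleton.\<close>

lemma Rad_properties:
  assumes "y \<in> {0..1}" "0 < q" "q < 1"
  shows "0 < Rad \<mu> q y" "measure \<mu> {y - Rad \<mu> q y..y + Rad \<mu> q y} = q"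
proof -
  define G where "G r = F (y + r) - F (y - r)" for r
  have "continuous_on {0..1} G"
    unfolding G_def by (intro continuous_intros continuous_on_compose2[OF continuous_F]) auto
  moreover have "G 0 = 0" "G 1 = 1"
    using F_eq_1[of "y + 1"] F_eq_0[of "y - 1"] assms by (auto simp: G_def)
  ultimately obtain r where r: "0 \<le> r" "G r = q"
    using IVT'[of G 0 q 1] assms by auto
  have unique: "\<not> s < t" if "0 \<le> s" "0 \<le> t" "G s = q" "G t = q" for s t
  proof
    assume "s < t"
    have "F (y + s) \<le> F (y + t)" "F (y - t) \<le> F (y - s)"
      using \<open>s < t\<close> by (auto intro: F_mono)
    then have eq: "F (y + s) = F (y + t)" "F (y - t) = F (y - s)"
      using that by (auto simp: G_def)
    have "1 \<le> y + s"
      by (rule ccontr) (use F_strict'[of "y + s" "y + t"] eq(1) \<open>s < t\<close> assms(1) that(1) in auto)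
    moreover have "y - s \<le> 0"
      by (rule ccontr) (use F_strict'[of "y - t" "y - s"] eq(2) \<open>s < t\<close> assms(1) that(1) in auto)
    ultimately show False
      using that assms F_eq_1[of "y + s"] F_eq_0[of "y - s"] by (simp add: G_def)
  qed
  have "{s. 0 \<le> s \<and> measure \<mu> {y - s..y + s} = q} = {s. 0 \<le> s \<and> G s = q}"
    by (auto simp: measure_Icc G_def)
  also have "\<dots> = {r}"
  proof -
    have "s = r" if "0 \<le> s" "G s = q" for s
      using unique[of s r] unique[of r s] that r by linarith
    then show ?thesis using r by blast
  qed
  finally have "Rad \<mu> q y = r" by (simp add: Rad_def)
  moreover have "r \<noteq> 0" using r \<open>G 0 = 0\<close> assms by auto
  ultimately show "0 < Rad \<mu> q y" "measure \<mu> {y - Rad \<mu> q y..y + Rad \<mu> q y} = q"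
    using r by (auto simp: measure_Icc G_def)
qed

section \<open>Quantile function\<close>

definition Q :: "real \<Rightarrow> real" where "Q = the_inv_into {0..1} F"

lemma inj_on_F: "inj_on F {0..1}"
proof (rule inj_onI)
  fix x y
  assume "x \<in> {0..1}" "y \<in> {0..1}" "F x = F y"
  then show "x = y"
    using F_strict[of x y] F_strict[of y x] by (cases x y rule: linorder_cases) auto
qed

lemma image_F: "F ` {0..1} = {0..1}"
proof
  show "{0..1} \<subseteq> F ` {0..1}"
    using IVT'[of F 0 _ 1] F_eq_0[of 0] F_1 continuous_on_subset[OF continuous_F] by fastforce
qed (auto simp: F_bounds)

lemma
  assumes "0 \<le> u" "u \<le> 1"
  shows Q_ge_0: "0 \<le> Q u" and Q_le_1: "Q u \<le> 1" and F_Q: "F (Q u) = u"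
  using the_inv_into_into[OF inj_on_F, of u "{0..1}"] f_the_inv_into_f[OF inj_on_F, of u] assms
  unfolding Q_def image_F by auto

lemma Q_F: "0 \<le> t \<Longrightarrow> t \<le> 1 \<Longrightarrow> Q (F t) = t"
  unfolding Q_def by (rule the_inv_into_f_f[OF inj_on_F]) simp

lemma Q_strict:
  assumes "0 \<le> u" "u < v" "v \<le> 1"
  shows "Q u < Q v"
proof (rule ccontr)
  assume "\<not> ?thesis"
  then have "F (Q v) \<le> F (Q u)" by (intro F_mono) simp
  then show False using assms by (simp add: F_Q)
qed

lemma Q_mono: "0 \<le> u \<Longrightarrow> u \<le> v \<Longrightarrow> v \<le> 1 \<Longrightarrow> Q u \<le> Q v"
  using Q_strict[of u v] by (cases "u = v") auto

lemma continuous_Q: "continuous_on {0..1} Q"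
  using continuous_on_inv[of "{0..1}" F Q, unfolded image_F] continuous_on_subset[OF continuous_F, of "{0..1}"] Q_F
  by simp

text \<open>By the mean value theorem the chord slopes of \<open>Q\<close> are reciprocals of values
  of \<open>f\<close>, and \<open>f\<close> is nonincreasing on \<open>[0, m]\<close>, which
  \<open>Q\<close> reaches from \<open>[0, F m]\<close>.\<close>

lemma Q_convex:
  assumes "0 \<le> x" "x < y" "y < z" "z \<le> F m"
  shows "(Q y - Q x) * (z - y) \<le> (Q z - Q y) * (y - x)"
proof -
  have xyz: "y \<le> 1" "z \<le> 1" using assms F_bounds(2)[of m] by linarith+
  have "Q x < Q y" "Q y < Q z" using assms xyz by (auto intro: Q_strict)
  have le: "0 \<le> Q x" "Q z \<le> m" "m \<le> 1"
    using Q_mono[of z "F m"] Q_F[of m] m assms xyz F_bounds Q_ge_0[of x] by auto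
  obtain a where a: "Q x < a" "a < Q y" "F (Q y) - F (Q x) = (Q y - Q x) * f a"
    using F_mvt[of "Q x" "Q y"] \<open>Q x < Q y\<close> \<open>Q y < Q z\<close> le by auto
  obtain b where b: "Q y < b" "b < Q z" "F (Q z) - F (Q y) = (Q z - Q y) * f b"
    using F_mvt[of "Q y" "Q z"] \<open>Q x < Q y\<close> \<open>Q y < Q z\<close> le by auto
  have "f b \<le> f a" using a b le by (intro noninc) auto
  then have "(Q y - Q x) * (Q z - Q y) * f b \<le> (Q y - Q x) * (Q z - Q y) * f a"
    using \<open>Q x < Q y\<close> \<open>Q y < Q z\<close> by (intro mult_left_mono) auto
  then show ?thesis using a(3) b(3) assms xyz by (simp add: F_Q ac_simps)
qed

lemma Q_concave:
  assumes "F m \<le> x" "x < y" "y < z" "z \<le> 1"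
  shows "(Q z - Q y) * (y - x) \<le> (Q y - Q x) * (z - y)"
proof -
  have xyz: "0 \<le> x" "0 \<le> y" "0 \<le> z" using assms F_bounds(1)[of m] by linarith+
  have "Q x < Q y" "Q y < Q z" using assms xyz by (auto intro: Q_strict)
  have le: "0 \<le> m" "m \<le> Q x" "Q z \<le> 1"
    using Q_mono[of "F m" x] Q_F[of m] m assms xyz F_bounds Q_le_1[of z] by auto
  obtain a where a: "Q x < a" "a < Q y" "F (Q y) - F (Q x) = (Q y - Q x) * f a"
    using F_mvt[of "Q x" "Q y"] \<open>Q x < Q y\<close> \<open>Q y < Q z\<close> le by auto
  obtain b where b: "Q y < b" "b < Q z" "F (Q z) - F (Q y) = (Q z - Q y) * f b"
    using F_mvt[of "Q y" "Q z"] \<open>Q x < Q y\<close> \<open>Q y < Q z\<close> le by auto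
  have "f a \<le> f b" using a b le by (intro nondec) auto
  then have "(Q y - Q x) * (Q z - Q y) * f a \<le> (Q y - Q x) * (Q z - Q y) * f b"
    using \<open>Q x < Q y\<close> \<open>Q y < Q z\<close> by (intro mult_left_mono) auto
  then show ?thesis using a(3) b(3) assms xyz by (simp add: F_Q ac_simps)
qed

section \<open>Truncated first moments and the cost of quantile intervals\<close>

definition H :: "real \<Rightarrow> real" where "H t = (\<integral>x. indicator {..t} x * x \<partial>\<mu>)"

lemma integrable_indicator_mult:
  assumes "A \<in> sets borel"
  shows "integrable \<mu> (\<lambda>x. indicator A x * x)" "integrable \<mu> (\<lambda>x. indicator A x * \<bar>x - c\<bar>)"
    "integrable \<mu> (indicator A :: real \<Rightarrow> real)"
proof -
  show "integrable \<mu> (\<lambda>x. indicator A x * x)"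
    by (rule integrable_bounded_on_unit[of _ 1]) (use assms in \<open>auto simp: indicator_def\<close>)
  show "integrable \<mu> (\<lambda>x. indicator A x * \<bar>x - c\<bar>)"
    by (rule integrable_bounded_on_unit[of _ "1 + \<bar>c\<bar>"]) (use assms in \<open>auto simp: indicator_def\<close>)
  show "integrable \<mu> (indicator A :: real \<Rightarrow> real)"
    by (rule integrable_bounded_on_unit[of _ 1]) (use assms in \<open>auto simp: indicator_def\<close>)
qed

lemma H_diff:
  assumes "a \<le> b"
  shows "H b - H a = (\<integral>x. indicator {a<..b} x * x \<partial>\<mu>)"
proof -
  have "H b - H a = (\<integral>x. indicator {..b} x * x - indicator {..a} x * x \<partial>\<mu>)"
    unfolding H_def using integrable_indicator_mult by (intro Bochner_Integration.integral_diff[symmetric]) auto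
  also have "\<dots> = (\<integral>x. indicator {a<..b} x * x \<partial>\<mu>)"
    using assms by (intro Bochner_Integration.integral_cong) (auto simp: indicator_def)
  finally show ?thesis .
qed

lemma integral_Ioc_shift:
  assumes "a \<le> b"
  shows "integrable \<mu> (\<lambda>x. indicator {a<..b} x * (x - c))"
    "(\<integral>x. indicator {a<..b} x * (x - c) \<partial>\<mu>) = H b - H a - c * (F b - F a)"
proof -
  have int: "integrable \<mu> (\<lambda>x. indicator {a<..b} x * x)" "integrable \<mu> (\<lambda>x. c * indicator {a<..b} x)"
    using integrable_indicator_mult by (auto intro!: integrable_mult_right)
  have eq: "(\<lambda>x. indicator {a<..b} x * (x - c)) = (\<lambda>x. indicator {a<..b} x * x - c * indicator {a<..b} x)"
    by (simp add: algebra_simps)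
  show "integrable \<mu> (\<lambda>x. indicator {a<..b} x * (x - c))"
    unfolding eq using int by (rule Bochner_Integration.integrable_diff)
  show "(\<integral>x. indicator {a<..b} x * (x - c) \<partial>\<mu>) = H b - H a - c * (F b - F a)"
    unfolding eq Bochner_Integration.integral_diff[OF int]
    by (simp add: H_diff[OF assms] measure_Ioc[OF assms])
qed

lemma H_diff_bounds:
  assumes "a \<le> b"
  shows "a * (F b - F a) \<le> H b - H a" "H b - H a \<le> b * (F b - F a)"
proof -
  have "0 \<le> (\<integral>x. indicator {a<..b} x * (x - a) \<partial>\<mu>)"
    by (intro Bochner_Integration.integral_nonneg) (auto simp: indicator_def)
  then show "a * (F b - F a) \<le> H b - H a" by (simp add: integral_Ioc_shift[OF assms])
  have "(\<integral>x. indicator {a<..b} x * (x - b) \<partial>\<mu>) \<le> (\<integral>x. 0 \<partial>\<mu>)"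
    by (intro integral_mono integral_Ioc_shift assms) (auto simp: indicator_def)
  then show "H b - H a \<le> b * (F b - F a)" by (simp add: integral_Ioc_shift[OF assms])
qed

text \<open>This is the unnormalised Lorenz curve of the measure, an antiderivative of the quantile
  function.\<close>

definition K :: "real \<Rightarrow> real" where "K u = H (Q u)"

text \<open>Outside the unit interval \<open>Q (F t)\<close> differs from \<open>t\<close>, but no
  mass lies between them, so the truncated moments agree.\<close>

lemma K_F: "K (F t) = H t"
proof -
  have "F (Q (F t)) = F t" by (rule F_Q) (rule F_bounds)+
  then show ?thesis
    using H_diff_bounds[of t "Q (F t)"] H_diff_bounds[of "Q (F t)" t]
    unfolding K_def by (cases "t \<le> Q (F t)") auto
qed

text \<open>The difference quotient lies between \<open>Q u\<close> and \<open>Q v\<close>, and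
  \<open>Q\<close> is continuous.\<close>

lemma DERIV_K:
  assumes u: "u \<in> {0..1}"
  shows "(K has_real_derivative Q u) (at u within {0..1})"
proof -
  have bounds: "Q s * (t - s) \<le> K t - K s \<and> K t - K s \<le> Q t * (t - s)" if "0 \<le> s" "s \<le> t" "t \<le> 1" for s t
    using H_diff_bounds[of "Q s" "Q t"] Q_mono[of s t] that by (simp add: K_def F_Q)
  have quotient: "\<bar>(K v - K u) / (v - u) - Q u\<bar> \<le> \<bar>Q v - Q u\<bar>" if v: "v \<in> {0..1}" "v \<noteq> u" for v
  proof (cases "u < v")
    case True
    then have "Q u \<le> (K v - K u) / (v - u)" "(K v - K u) / (v - u) \<le> Q v"
      using bounds[of u v] u v by (auto simp: divide_le_eq le_divide_eq)
    then show ?thesis by simp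
  next
    case False
    then have "v < u" using v by simp
    then have "Q v \<le> (K u - K v) / (u - v)" "(K u - K v) / (u - v) \<le> Q u"
      using bounds[of v u] u v by (auto simp: divide_le_eq le_divide_eq)
    moreover have "(K v - K u) / (v - u) = (K u - K v) / (u - v)"
      by (metis minus_diff_eq minus_divide_divide)
    ultimately show ?thesis by simp
  qed
  have "((\<lambda>v. Q v) \<longlongrightarrow> Q u) (at u within {0..1})"
    using continuous_Q u by (simp add: continuous_on_def)
  then have "((\<lambda>v. \<bar>Q v - Q u\<bar>) \<longlongrightarrow> 0) (at u within {0..1})"
    by (intro tendsto_rabs_zero) (simp add: LIM_zero)
  then have "((\<lambda>v. (K v - K u) / (v - u) - Q u) \<longlongrightarrow> 0) (at u within {0..1})"
    by (rule Lim_null_comparison[rotated]) (use quotient in \<open>auto simp: eventually_at_filter\<close>)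
  then show ?thesis
    by (simp add: has_field_derivative_iff LIM_zero_iff)
qed

text \<open>With \<open>q = 2 * h\<close>, \<open>V h a\<close> is the cost of serving the agents between the quantiles \<open>a\<close> and
  \<open>a + q\<close> from their median.\<close>
definition V :: "real \<Rightarrow> real \<Rightarrow> real" where
  "V h a = K (a + 2 * h) - 2 * K (a + h) + K a"

lemma V_ge_min_endpoints:
  assumes "0 < h" "0 \<le> a" "a + 2 * h \<le> 1"
  shows "min (V h 0) (V h (1 - 2 * h)) \<le> V h a"
proof -
  have "1 - 2 * h + h = 1 - h" by simp
  then show ?thesis
    using second_difference_ge_min_endpoints[OF Q_convex Q_concave DERIV_K assms]
    by (simp add: V_def)
qed

lemma integral_abs_diff_split:
  assumes "a \<le> y" "y \<le> b"
  shows "(\<integral>x. indicator {a<..b} x * \<bar>x - y\<bar> \<partial>\<mu>) = H b - 2 * H y + H a - y * (F b - 2 * F y + F a)"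
proof -
  have "(\<lambda>x. indicator {a<..b} x * \<bar>x - y\<bar>)
      = (\<lambda>x. indicator {y<..b} x * (x - y) - indicator {a<..y} x * (x - y))"
    using assms by (auto simp: indicator_def)
  then have "(\<integral>x. indicator {a<..b} x * \<bar>x - y\<bar> \<partial>\<mu>)
      = (H b - H y - y * (F b - F y)) - (H y - H a - y * (F y - F a))"
    using assms by (simp only: Bochner_Integration.integral_diff integral_Ioc_shift)
  then show ?thesis by (simp add: algebra_simps)
qed

text \<open>Among the sets of measure \<open>q\<close>, the ball around \<open>y\<close> minimises the transport cost to \<open>y\<close>.\<close>
lemma Wc_quantile_le_V:
  assumes "0 < h" "2 * h < 1" "0 \<le> a" "a + 2 * h \<le> 1"
  shows "Wc \<mu> (2 * h) (Q (a + h)) \<le> V h a"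
proof -
  define y where "y = Q (a + h)"
  define R where "R = Rad \<mu> (2 * h) y"
  define A where "A = {Q a<..Q (a + 2 * h)}"
  define B where "B = {y - R..y + R}"
  have y: "y \<in> {0..1}" using Q_ge_0 Q_le_1 assms by (simp add: y_def)
  have le: "Q a \<le> y" "y \<le> Q (a + 2 * h)" using assms by (auto simp: y_def intro!: Q_mono)
  have A: "measure \<mu> A = 2 * h" "A \<in> sets borel"
    using le assms by (auto simp: A_def measure_Ioc F_Q)
  have B: "measure \<mu> B = 2 * h" "B \<in> sets borel"
    using Rad_properties[OF y, of "2 * h"] assms by (auto simp: B_def R_def)
  have int: "integrable \<mu> (\<lambda>x. indicator S x * (\<bar>x - y\<bar> - R))"
    "(\<integral>x. indicator S x * (\<bar>x - y\<bar> - R) \<partial>\<mu>) = (\<integral>x. indicator S x * \<bar>x - y\<bar> \<partial>\<mu>) - R * measure \<mu> S"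
    if S: "S \<in> sets borel" for S
  proof -
    have eq: "(\<lambda>x. indicator S x * (\<bar>x - y\<bar> - R)) = (\<lambda>x. indicator S x * \<bar>x - y\<bar> - R * indicator S x)"
      by (simp add: algebra_simps)
    note int = integrable_indicator_mult(2)[OF S, of y] integrable_mult_right[OF integrable_indicator_mult(3)[OF S], of R]
    show "integrable \<mu> (\<lambda>x. indicator S x * (\<bar>x - y\<bar> - R))"
      unfolding eq using int by (rule Bochner_Integration.integrable_diff)
    show "(\<integral>x. indicator S x * (\<bar>x - y\<bar> - R) \<partial>\<mu>) = (\<integral>x. indicator S x * \<bar>x - y\<bar> \<partial>\<mu>) - R * measure \<mu> S"
      unfolding eq Bochner_Integration.integral_diff[OF int] using S by simp
  qed
  \<comment> \<open>The shifted cost \<open>\<bar>x - y\<bar> - R\<close> is nonpositive on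
    \<open>B\<close> and positive off it. The shift then cancels, as \<open>A\<close> and
    \<open>B\<close> have the same measure.\<close>
  have "(\<integral>x. indicator B x * (\<bar>x - y\<bar> - R) \<partial>\<mu>) \<le> (\<integral>x. indicator A x * (\<bar>x - y\<bar> - R) \<partial>\<mu>)"
    by (rule integral_mono[OF int(1)[OF B(2)] int(1)[OF A(2)]]) (auto simp: indicator_def B_def)
  then have "(\<integral>x. indicator B x * \<bar>x - y\<bar> \<partial>\<mu>) \<le> (\<integral>x. indicator A x * \<bar>x - y\<bar> \<partial>\<mu>)"
    by (simp add: int A B)
  \<comment> \<open>Since \<open>y\<close> is the median of \<open>A\<close>, the term with the
    factor \<open>y\<close> vanishes.\<close>
  also have "\<dots> = V h a"
    unfolding A_def integral_abs_diff_split[OF le] using assms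
    by (simp add: y_def F_Q V_def K_def)
  finally show ?thesis
    by (simp add: Wc_def set_lebesgue_integral_def B_def R_def y_def)
qed

text \<open>The ball around \<open>y\<close> is the quantile interval starting at
  \<open>a = F l\<close>, and its median \<open>c\<close> is the cheapest position from which to
  serve it.\<close>

lemma V_le_Wc:
  assumes "0 < h" "2 * h < 1" "y \<in> {0..1}"
  obtains a where "0 \<le> a" "a + 2 * h \<le> 1" "V h a \<le> Wc \<mu> (2 * h) y"
proof -
  define R where "R = Rad \<mu> (2 * h) y"
  define l where "l = y - R"
  define r where "r = y + R"
  define c where "c = Q (F l + h)"
  have R: "0 < R" "measure \<mu> {l..r} = 2 * h"
    using Rad_properties[OF assms(3), of "2 * h"] assms by (auto simp: R_def l_def r_def)
  then have Fr: "F r = F l + 2 * h" by (simp add: l_def r_def measure_Icc)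
  have Fl: "0 \<le> F l" "F l + 2 * h \<le> 1" using F_bounds[of l] F_bounds[of r] Fr by auto
  have Fc: "F c = F l + h" using Fl assms by (simp add: c_def F_Q)
  have "l \<le> c" "c \<le> r" using F_mono[of c l] F_mono[of r c] Fc Fr assms by linarith+
  have "V h (F l) = H r - 2 * H c + H l"
    using K_F[of r] K_F[of l] K_F[of c] by (simp add: V_def Fr Fc)
  \<comment> \<open>The median halves the mass, so the terms with \<open>y\<close> cancel and can be
    inserted freely. The resulting signed integrand is at most
    \<open>\<bar>x - y\<bar>\<close>.\<close>
  also have "\<dots> = (H r - H c - y * (F r - F c)) - (H c - H l - y * (F c - F l))"
    by (simp add: Fc Fr)
  also have "\<dots> = (\<integral>x. indicator {c<..r} x * (x - y) - indicator {l<..c} x * (x - y) \<partial>\<mu>)"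
    using \<open>l \<le> c\<close> \<open>c \<le> r\<close> by (simp only: Bochner_Integration.integral_diff integral_Ioc_shift)
  also have "\<dots> \<le> (\<integral>x. indicator {l..r} x * \<bar>x - y\<bar> \<partial>\<mu>)"
    using \<open>l \<le> c\<close> \<open>c \<le> r\<close>
    by (intro integral_mono Bochner_Integration.integrable_diff integral_Ioc_shift integrable_indicator_mult)
      (auto simp: indicator_def)
  also have "\<dots> = Wc \<mu> (2 * h) y"
    by (simp add: Wc_def set_lebesgue_integral_def l_def r_def R_def)
  finally show ?thesis using that Fl by blast
qed

lemma min_V_endpoints_le_Wc:
  assumes "0 < h" "2 * h < 1" "y \<in> {0..1}"
  shows "min (V h 0) (V h (1 - 2 * h)) \<le> Wc \<mu> (2 * h) y"
proof -
  obtain a where "0 \<le> a" "a + 2 * h \<le> 1" "V h a \<le> Wc \<mu> (2 * h) y"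
    by (rule V_le_Wc[OF assms])
  then show ?thesis using V_ge_min_endpoints[OF assms(1), of a] by linarith
qed

text \<open>Reflection passes from \<open>f\<close> to \<open>F\<close> and \<open>Q\<close>, and
  then to \<open>K\<close> up to an affine term, which a second difference does not see. The
  identities for \<open>F\<close> and \<open>K\<close> follow from vanishing derivatives.\<close>

lemma V_endpoints_symmetric:
  assumes sym: "\<And>x. x \<in> {0..1} \<Longrightarrow> f x = f (1 - x)" and "0 < h" "2 * h < 1"
  shows "V h 0 = V h (1 - 2 * h)"
proof -
  have refl_deriv: "((\<lambda>t. g (1 - t)) has_real_derivative - g' (1 - t)) (at t within {0..1})"
    if "\<And>t. t \<in> {0..1} \<Longrightarrow> (g has_real_derivative g' t) (at t within {0..1})" "t \<in> {0..1}"
    for g g' :: "real \<Rightarrow> real" and t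
  proof -
    have "((\<lambda>t. 1 - t) has_real_derivative - 1) (at t within {0..1})"
      by (auto intro!: derivative_eq_intros)
    moreover have "(\<lambda>t. 1 - t) ` {0..1} = {0..1::real}" by auto
    moreover have "1 - t \<in> {0..1}" using that by auto
    ultimately show ?thesis
      using DERIV_image_chain[of g "g' (1 - t)" "\<lambda>t. 1 - t" t "{0..1}" "-1"] that(1)[of "1 - t"]
      by (simp add: o_def)
  qed
  have F_refl: "F (1 - t) + F t = 1" if "t \<in> {0..1}" for t
  proof -
    have "\<exists>c. \<forall>t\<in>{0..1}. F (1 - t) + F t = c"
    proof (rule has_field_derivative_zero_constant)
      fix t :: real assume t: "t \<in> {0..1}"
      from DERIV_add[OF refl_deriv[OF DERIV_F t] DERIV_F[OF t]]
      show "((\<lambda>t. F (1 - t) + F t) has_real_derivative 0) (at t within {0..1})"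
        using sym[OF t] by simp
    qed simp
    then obtain c where c: "\<And>t. t \<in> {0..1} \<Longrightarrow> F (1 - t) + F t = c" by blast
    show ?thesis using c[of 0] c[OF that] F_1 F_eq_0[of 0] by simp
  qed
  have Q_refl: "Q (1 - u) = 1 - Q u" if "u \<in> {0..1}" for u
  proof -
    have u: "0 \<le> u" "u \<le> 1" using that by auto
    have "F (1 - Q u) = 1 - u"
      using F_refl[of "Q u"] Q_ge_0[OF u] Q_le_1[OF u] F_Q[OF u] by simp
    then show ?thesis using Q_F[of "1 - Q u"] Q_ge_0[OF u] Q_le_1[OF u] by simp
  qed
  have "\<exists>c. \<forall>u\<in>{0..1}. K (1 - u) - K u + u = c"
  proof (rule has_field_derivative_zero_constant)
    fix u :: real assume u: "u \<in> {0..1}"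
    from DERIV_add[OF DERIV_diff[OF refl_deriv[OF DERIV_K u] DERIV_K[OF u]] DERIV_ident]
    show "((\<lambda>u. K (1 - u) - K u + u) has_real_derivative 0) (at u within {0..1})"
      using Q_refl[OF u] by simp
  qed simp
  then obtain c where c: "\<And>u. u \<in> {0..1} \<Longrightarrow> K (1 - u) - K u + u = c" by blast
  \<comment> \<open>At 0, \<open>h\<close> and \<open>2 * h\<close> the constant \<open>c\<close>
    and the linear term cancel in the second difference.\<close>
  show ?thesis
    using c[of 0] c[of h] c[of "2 * h"] assms(2,3) by (simp add: V_def)
qed

end

section \<open>Optimality\<close>

text \<open>As \<open>0 < p < 1\<close>, the quantile lies strictly inside the unit interval, so
  \<open>F\<close> crosses the level \<open>p\<close> strictly there and the sample percentile
  concentrates at \<open>Q p\<close>. The limit is the mass of the ball minus its transport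
  cost.\<close>

lemma (in dipped_density) optimal_PM_quantile:
  assumes p: "0 < p" "p < 1" and q: "0 < q" "q < 1"
    and min: "\<And>y. y \<in> {0..1} \<Longrightarrow> Wc \<mu> q (Q p) \<le> Wc \<mu> q y"
  shows "optimal_PM \<mu> q p"
  unfolding optimal_PM_def
proof (intro bexI[of _ "Q p"] conjI)
  define R where "R = Rad \<mu> q (Q p)"
  define B where "B = {Q p - R..Q p + R}"
  show Qp: "Q p \<in> {0..1}" using p Q_ge_0[of p] Q_le_1[of p] by simp
  have ball: "measure \<mu> B = q"
    using Rad_properties[OF Qp q] by (simp add: R_def B_def)
  have "F t < p" if "t < Q p" for t
  proof -
    have "0 < Q p" using F_eq_0[of "Q p"] F_Q[of p] p by (cases "0 < Q p") auto
    then show ?thesis using F_strict'[of t "Q p"] Qp F_Q[of p] p that by simp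
  qed
  moreover have "p < F t" if "Q p < t" for t
  proof -
    have "Q p < 1" using F_eq_1[of "Q p"] F_Q[of p] p by (cases "Q p < 1") auto
    then show ?thesis using F_strict'[of "Q p" t] Qp F_Q[of p] p that by simp
  qed
  ultimately have "(\<lambda>n. \<integral>x. SW n q x (PM p n x) \<partial>PiM {..<n} (\<lambda>_. \<mu>))
      \<longlonglongrightarrow> (\<integral>z\<in>B. 1 - \<bar>z - Q p\<bar> \<partial>\<mu>)"
    unfolding B_def using p q Qp ball
    by (intro expected_SW_PM_tendsto prob_space_axioms sets_dens_measure AE_unit_interval)
      (auto simp: F_def B_def)
  moreover have "(\<integral>z\<in>B. 1 - \<bar>z - Q p\<bar> \<partial>\<mu>) = q - Wc \<mu> q (Q p)"
  proof -
    have "B \<in> sets borel" by (simp add: B_def)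
    have "(\<integral>z\<in>B. 1 - \<bar>z - Q p\<bar> \<partial>\<mu>) = (\<integral>z. indicator B z - indicator B z * \<bar>z - Q p\<bar> \<partial>\<mu>)"
      by (simp add: set_lebesgue_integral_def algebra_simps)
    also have "\<dots> = measure \<mu> B - (\<integral>z. indicator B z * \<bar>z - Q p\<bar> \<partial>\<mu>)"
      using \<open>B \<in> sets borel\<close> by (subst Bochner_Integration.integral_diff) (auto intro!: integrable_indicator_mult)
    finally show ?thesis
      by (simp add: ball) (simp add: Wc_def set_lebesgue_integral_def B_def R_def)
  qed
  ultimately show "(\<lambda>n. \<integral>x. SW n q x (PM p n x) \<partial>PiM {..<n} (\<lambda>_. \<mu>)) \<longlonglongrightarrow> q - Wc \<mu> q (Q p)"
    by simp
  show "\<forall>y\<in>{0..1}. q - Wc \<mu> q y \<le> q - Wc \<mu> q (Q p)"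
    using min by simp
qed

lemma single_dipped_imp_dipped_density:
  assumes "prob_density f" "continuous_on {0..1} f" "single_dipped f"
  obtains m where "dipped_density f m"
proof -
  obtain m where m: "m \<in> {0..1}" "\<And>x y. x \<in> {0..m} \<Longrightarrow> y \<in> {0..m} \<Longrightarrow> x \<le> y \<Longrightarrow> f y \<le> f x"
    "\<And>x y. x \<in> {m..1} \<Longrightarrow> y \<in> {m..1} \<Longrightarrow> x \<le> y \<Longrightarrow> f x \<le> f y"
    "\<And>x. x \<in> {0..1} \<Longrightarrow> x \<noteq> m \<Longrightarrow> f m < f x"
    using assms(3) unfolding single_dipped_def by blast
  have "0 \<le> f m" using assms(1) m(1) by (simp add: prob_density_def)
  then have "dipped_density f m"
    using assms m(1) m(2) m(3) by unfold_locales (auto intro: le_less_trans[OF _ m(4)])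
  then show ?thesis using that by blast
qed

theorem theorem3p10:
  fixes f :: "real \<Rightarrow> real" and q :: real
  assumes "prob_density f"
    and "continuous_on {0..1} f"
    and "single_dipped f"
    and "0 < q" and "q < 1"
  shows "((\<forall>x\<in>{0..1}. f x = f (1 - x)) \<longrightarrow> optimal_PM (dens_measure f) q (q / 2))
       \<and> (optimal_PM (dens_measure f) q (q / 2) \<or> optimal_PM (dens_measure f) q (1 - q / 2))"
proof -
  obtain m where "dipped_density f m"
    by (rule single_dipped_imp_dipped_density[OF assms(1-3)])
  then interpret dipped_density f m .
  define h where "h = q / 2"
  have h: "0 < h" "2 * h < 1" "q = 2 * h" using assms by (auto simp: h_def)
  have min: "min (V h 0) (V h (1 - 2 * h)) \<le> Wc \<mu> q y" if "y \<in> {0..1}" for y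
    using min_V_endpoints_le_Wc[OF h(1,2) that] by (simp add: h(3))
  \<comment> \<open>The levels \<open>h\<close> and \<open>1 - h\<close> are the medians of the two
    extreme quantile intervals \<open>[0, q]\<close> and \<open>[1 - q, 1]\<close>; the cheaper of
    the two attains the lower bound \<open>min\<close>.\<close>
  have left: "optimal_PM \<mu> q h" if "V h 0 \<le> V h (1 - 2 * h)"
  proof (rule optimal_PM_quantile)
    show "Wc \<mu> q (Q h) \<le> Wc \<mu> q y" if "y \<in> {0..1}" for y
      using Wc_quantile_le_V[of h 0] min[OF that] \<open>V h 0 \<le> _\<close> h by simp
  qed (use h in auto)
  have right: "optimal_PM \<mu> q (1 - h)" if "V h (1 - 2 * h) \<le> V h 0"
  proof (rule optimal_PM_quantile)
    have "1 - 2 * h + h = 1 - h" by simp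
    then show "Wc \<mu> q (Q (1 - h)) \<le> Wc \<mu> q y" if "y \<in> {0..1}" for y
      using Wc_quantile_le_V[of h "1 - 2 * h"] min[OF that] \<open>V h (1 - 2 * h) \<le> _\<close> h by simp
  qed (use h in auto)
  have "optimal_PM \<mu> q h" if "\<forall>x\<in>{0..1}. f x = f (1 - x)"
    by (rule left, rule eq_refl, rule V_endpoints_symmetric[OF bspec[OF that] h(1,2)])
  then show ?thesis
    using left right linear[of "V h 0" "V h (1 - 2 * h)"] unfolding h_def by blast
qed

end
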